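(* Let $(N,g)$ be a paraquaternionic CR-submanifold of a paraquaternionic K\"ahler manifold $(M,\sigma,g)$, and let $\{J_1,J_2,J_3\}$ be a canonical local basis of $\sigma$ on an open set $U\subset M$. For $x\in U\cap N$ put $\nu_{\alpha x}=J_\alpha(\mathcal{D}^\perp_x)$, $\alpha\in\{1,2,3\}$, and $\nu^\perp_x=\nu_{1x}\oplus\nu_{2x}\oplus\nu_{3x}$. Then: (i) $J_\alpha(\nu_{\alpha x})=\mathcal{D}^\perp_x$ for all $x\in U\cap N$ and $\alpha\in\{1,2,3\}$; (ii) $J_\alpha(\nu_{\beta x})=\nu_{\gamma x}$ for any even permutation $(\alpha,\beta,\gamma)$ of $(1,2,3)$ and any $x\in U\cap N$; (iii) the mapping $\nu^\perp:x\in N\mapsto\nu^\perp_x$ defines a non-degenerate distribution (subbundle of the normal bundle $TN^\perp$) of dimension $3s$, where $s=\dim\mathcal{D}^\perp_x$; (iv) $J_\alpha(\nu_x)=\nu_x$ for all $x\in U\cap N$ and $\alpha\in\{1,2,3\}$, where $\nu$ is the complementary orthogonal distribution to $\nu^\perp$ in $TN^\perp$.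
   Context: Everything is smooth. Put $\epsilon_1=1$, $\epsilon_2=\epsilon_3=-1$; indices $\alpha\in\{1,2,3\}$ are taken modulo 3. An almost paraquaternionic structure on $M$ is a rank-3 subbundle $\sigma\subset \mathrm{End}(TM)$ admitting on coordinate neighborhoods $U$ a canonical local basis $\{J_1,J_2,J_3\}$ with $J_\alpha^2=-\epsilon_\alpha \mathrm{Id}$ and $J_\alpha J_{\alpha+1}=-J_{\alpha+1}J_\alpha=\epsilon_{\alpha+2}J_{\alpha+2}$; on overlaps two canonical local bases are related by an $SO(2,1)$-valued matrix of functions. $(M,\sigma,g)$ is almost paraquaternionic hermitian if $g$ is a semi-Riemannian metric with $g(J_\alpha X,J_\alpha Y)=\epsilon_\alpha g(X,Y)$ for all $\alpha$ and all canonical local bases. It is paraquaternionic K\"ahler if moreover $\sigma$ is parallel with respect to the Levi-Civita connection of $g$. A non-degenerate (immersed) submanifold $N$ of $M$ is one on which the induced metric, again denoted $g$, is non-degenerate; $TN^\perp$ is its normal bundle. It is a paraquaternionic CR-submanifold if there is a non-degenerate distribution $\mathcal{D}\subset TN$ such that, for every canonical local basis on $U$ and $x\in U\cap N$, $J_\alpha\mathcal{D}_x=\mathcal{D}_x$ and $J_\alpha\mathcal{D}^\perp_x\subset T_x^\perp N$ for $\alpha\in\{1,2,3\}$, where $\mathcal{D}^\perp$ is the orthogonal complement of $\mathcal{D}$ in $TN$. The subspaces $\nu_{1x},\nu_{2x},\nu_{3x}$ of $T_xN^\perp$ are mutually orthogonal and non-degenerate, and $\nu^\perp_x$ does not depend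 on the choice of canonical local basis. *)

theory Defs
  imports "HOL-Analysis.Analysis"
begin

section \<open>Smooth maps between normed spaces\<close>

fun Ck_on :: "nat \<Rightarrow> 'a::real_normed_vector set \<Rightarrow> ('a \<Rightarrow> 'b::real_normed_vector) \<Rightarrow> bool" where
  "Ck_on 0 S f \<longleftrightarrow> continuous_on S f"
| "Ck_on (Suc k) S f \<longleftrightarrow>
     (\<forall>x\<in>S. f differentiable (at x)) \<and> (\<forall>v. Ck_on k S (\<lambda>x. frechet_derivative f (at x) v))"

text \<open>Only used for open \<open>S\<close> and finite-dimensional domains.\<close>

definition smooth_on :: "'a::real_normed_vector set \<Rightarrow> ('a \<Rightarrow> 'b::real_normed_vector) \<Rightarrow> bool" where
  "smooth_on S f \<longleftrightarrow> (\<forall>k. Ck_on k S f)"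


section \<open>Smooth manifolds\<close>

text \<open>A manifold is a whole (Hausdorff, second countable) type \<open>'m\<close> with a smooth atlas modelled
  on \<open>'e\<close>; its dimension is \<open>DIM('e)\<close>. A chart is a pair of a domain and a coordinate map.\<close>

type_synonym ('m, 'e) chart = "'m set \<times> ('m \<Rightarrow> 'e)"

definition chart_inv :: "('m, 'e) chart \<Rightarrow> 'e \<Rightarrow> 'm" where
  "chart_inv c = inv_into (fst c) (snd c)"

definition smooth_manifold ::
  "('m::{t2_space,second_countable_topology}, 'e::euclidean_space) chart set \<Rightarrow> bool" where
  "smooth_manifold A \<longleftrightarrow>
     (\<Union>c\<in>A. fst c) = UNIV \<and>
     (\<forall>c\<in>A. open (fst c) \<and> open (snd c ` fst c) \<and>
        homeomorphism (fst c) (snd c ` fst c) (snd c) (chart_inv c)) \<and>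
     (\<forall>c\<in>A. \<forall>d\<in>A. smooth_on (snd c ` (fst c \<inter> fst d)) (snd d \<circ> chart_inv c))"

text \<open>The tangent space at \<open>x\<close> is the model space \<open>'e\<close> itself, a vector being represented by its
  coordinates in a chart around \<open>x\<close> chosen once and for all. The coordinates of that vector in an
  arbitrary chart \<open>c\<close> around \<open>x\<close> are given by \<open>tcoord A c x\<close>.\<close>

definition chart_at :: "('m, 'e) chart set \<Rightarrow> 'm \<Rightarrow> ('m, 'e) chart" where
  "chart_at A x = (SOME c. c \<in> A \<and> x \<in> fst c)"

definition tcoord ::
  "('m, 'e::euclidean_space) chart set \<Rightarrow> ('m, 'e) chart \<Rightarrow> 'm \<Rightarrow> 'e \<Rightarrow> 'e" where
  "tcoord A c x = frechet_derivative (snd c \<circ> chart_inv (chart_at A x)) (at (snd (chart_at A x) x))"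

definition smooth_fun ::
  "('m, 'e::euclidean_space) chart set \<Rightarrow> 'm set \<Rightarrow> ('m \<Rightarrow> real) \<Rightarrow> bool" where
  "smooth_fun A V h \<longleftrightarrow> (\<forall>c\<in>A. smooth_on (snd c ` (V \<inter> fst c)) (h \<circ> chart_inv c))"

text \<open>The derivative \<open>v h\<close> of a function \<open>h\<close> in the direction of the tangent vector \<open>v\<close> at \<open>x\<close>.\<close>

definition tderiv ::
  "('m, 'e::euclidean_space) chart set \<Rightarrow> 'm \<Rightarrow> 'e \<Rightarrow> ('m \<Rightarrow> real) \<Rightarrow> real" where
  "tderiv A x v h = frechet_derivative (h \<circ> chart_inv (chart_at A x)) (at (snd (chart_at A x) x)) v"

definition smooth_map ::
  "('n::topological_space, 'f::euclidean_space) chart set \<Rightarrow>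
   ('m::topological_space, 'e::euclidean_space) chart set \<Rightarrow> ('n \<Rightarrow> 'm) \<Rightarrow> bool" where
  "smooth_map B A f \<longleftrightarrow> continuous_on UNIV f \<and>
     (\<forall>c\<in>B. \<forall>d\<in>A. smooth_on (snd c ` (fst c \<inter> f -` fst d)) (snd d \<circ> f \<circ> chart_inv c))"

definition tmap ::
  "('n, 'f::euclidean_space) chart set \<Rightarrow> ('m, 'e::euclidean_space) chart set \<Rightarrow>
   ('n \<Rightarrow> 'm) \<Rightarrow> 'n \<Rightarrow> 'f \<Rightarrow> 'e" where
  "tmap B A f x = frechet_derivative (snd (chart_at A (f x)) \<circ> f \<circ> chart_inv (chart_at B x))
     (at (snd (chart_at B x) x))"

definition immersion ::
  "('n::topological_space, 'f::euclidean_space) chart set \<Rightarrow>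
   ('m::topological_space, 'e::euclidean_space) chart set \<Rightarrow> ('n \<Rightarrow> 'm) \<Rightarrow> bool" where
  "immersion B A f \<longleftrightarrow> smooth_map B A f \<and> (\<forall>x. inj (tmap B A f x))"


section \<open>Sections and subbundles of pulled-back tangent bundles\<close>

text \<open>Smooth sections over \<open>V\<close> of the pull-back of the tangent bundle along \<open>f\<close>. For \<open>f = id\<close> these
  are the vector fields on \<open>V\<close>.\<close>

definition smooth_section_along ::
  "('n, 'f::euclidean_space) chart set \<Rightarrow> ('m, 'e::euclidean_space) chart set \<Rightarrow>
   ('n \<Rightarrow> 'm) \<Rightarrow> 'n set \<Rightarrow> ('n \<Rightarrow> 'e) \<Rightarrow> bool" where
  "smooth_section_along B A f V X \<longleftrightarrow>
     (\<forall>c\<in>B. \<forall>d\<in>A. smooth_on (snd c ` (V \<inter> fst c \<inter> f -` fst d))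
        ((\<lambda>x. tcoord A d (f x) (X x)) \<circ> chart_inv c))"

definition vector_field ::
  "('m, 'e::euclidean_space) chart set \<Rightarrow> 'm set \<Rightarrow> ('m \<Rightarrow> 'e) \<Rightarrow> bool" where
  "vector_field A V X \<longleftrightarrow> smooth_section_along A A id V X"

definition subbundle_along ::
  "('n::topological_space, 'f::euclidean_space) chart set \<Rightarrow> ('m, 'e::euclidean_space) chart set \<Rightarrow>
   ('n \<Rightarrow> 'm) \<Rightarrow> nat \<Rightarrow> ('n \<Rightarrow> 'e set) \<Rightarrow> bool" where
  "subbundle_along B A f r W \<longleftrightarrow>
     (\<forall>x. \<exists>V X. open V \<and> x \<in> V \<and>
        (\<forall>i<r. smooth_section_along B A f V (X i)) \<and>
        (\<forall>y\<in>V. span ((\<lambda>i. X i y) ` {..<r}) = W y \<and> dim (W y) = r))"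

definition distribution ::
  "('m::topological_space, 'e::euclidean_space) chart set \<Rightarrow> nat \<Rightarrow> ('m \<Rightarrow> 'e set) \<Rightarrow> bool" where
  "distribution A r W \<longleftrightarrow> subbundle_along A A id r W"

definition smooth_endo ::
  "('m::topological_space, 'e::euclidean_space) chart set \<Rightarrow> 'm set \<Rightarrow> ('m \<Rightarrow> 'e \<Rightarrow>\<^sub>L 'e) \<Rightarrow> bool" where
  "smooth_endo A U S \<longleftrightarrow>
     (\<forall>V X. open V \<and> V \<subseteq> U \<and> vector_field A V X \<longrightarrow>
        vector_field A V (\<lambda>x. blinfun_apply (S x) (X x)))"


section \<open>Semi-Riemannian metrics and the Levi-Civita connection\<close>

definition nondegenerate_on :: "('a::real_vector \<Rightarrow> 'a \<Rightarrow> real) \<Rightarrow> 'a set \<Rightarrow> bool" where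
  "nondegenerate_on b W \<longleftrightarrow> (\<forall>w\<in>W. (\<forall>v\<in>W. b w v = 0) \<longrightarrow> w = 0)"

definition orth_in :: "('a::real_vector \<Rightarrow> 'a \<Rightarrow> real) \<Rightarrow> 'a set \<Rightarrow> 'a set \<Rightarrow> 'a set" where
  "orth_in b W D = {w \<in> W. \<forall>v\<in>D. b w v = 0}"

text \<open>The index of a metric is not mentioned: it is locally constant, and for the paraquaternionic
  hermitian metrics below it is always half of the dimension.\<close>

definition semi_riemannian ::
  "('m::topological_space, 'e::euclidean_space) chart set \<Rightarrow> ('m \<Rightarrow> 'e \<Rightarrow> 'e \<Rightarrow> real) \<Rightarrow> bool" where
  "semi_riemannian A g \<longleftrightarrow>
     (\<forall>x. bilinear (g x) \<and> (\<forall>u v. g x u v = g x v u) \<and> nondegenerate_on (g x) UNIV) \<and>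
     (\<forall>V X Y. open V \<and> vector_field A V X \<and> vector_field A V Y \<longrightarrow>
        smooth_fun A V (\<lambda>x. g x (X x) (Y x)))"

definition affine_connection ::
  "('m, 'e::euclidean_space) chart set \<Rightarrow>
   (('m \<Rightarrow> 'e) \<Rightarrow> ('m \<Rightarrow> 'e) \<Rightarrow> 'm \<Rightarrow> 'e) \<Rightarrow> bool" where
  "affine_connection A nabla \<longleftrightarrow>
     (\<forall>X Y Z h. vector_field A UNIV X \<and> vector_field A UNIV Y \<and> vector_field A UNIV Z \<and>
        smooth_fun A UNIV h \<longrightarrow>
        vector_field A UNIV (nabla X Y) \<and>
        (\<forall>x. nabla (\<lambda>y. X y + Y y) Z x = nabla X Z x + nabla Y Z x \<and>
             nabla (\<lambda>y. h y *\<^sub>R X y) Y x = h x *\<^sub>R nabla X Y x \<and>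
             nabla X (\<lambda>y. Y y + Z y) x = nabla X Y x + nabla X Z x \<and>
             nabla X (\<lambda>y. h y *\<^sub>R Y y) x = tderiv A x (X x) h *\<^sub>R Y x + h x *\<^sub>R nabla X Y x))"

text \<open>Torsion-freeness \<open>nabla X Y - nabla Y X = [X, Y]\<close> is tested on smooth functions.\<close>

definition levi_civita ::
  "('m, 'e::euclidean_space) chart set \<Rightarrow> ('m \<Rightarrow> 'e \<Rightarrow> 'e \<Rightarrow> real) \<Rightarrow>
   (('m \<Rightarrow> 'e) \<Rightarrow> ('m \<Rightarrow> 'e) \<Rightarrow> 'm \<Rightarrow> 'e) \<Rightarrow> bool" where
  "levi_civita A g nabla \<longleftrightarrow> affine_connection A nabla \<and>
     (\<forall>X Y h x. vector_field A UNIV X \<and> vector_field A UNIV Y \<and> smooth_fun A UNIV h \<longrightarrow>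
        tderiv A x (nabla X Y x - nabla Y X x) h =
        tderiv A x (X x) (\<lambda>y. tderiv A y (Y y) h) - tderiv A x (Y x) (\<lambda>y. tderiv A y (X y) h)) \<and>
     (\<forall>X Y Z x. vector_field A UNIV X \<and> vector_field A UNIV Y \<and> vector_field A UNIV Z \<longrightarrow>
        tderiv A x (X x) (\<lambda>y. g y (Y y) (Z y)) = g x (nabla X Y x) (Z x) + g x (Y x) (nabla X Z x))"

text \<open>A bundle of endomorphisms is parallel if \<open>nabla X S\<close>, given by
  \<open>(nabla X S) Y = nabla X (S Y) - S (nabla X Y)\<close>, is again a section of it, for all its sections
  \<open>S\<close> and all vector fields \<open>X\<close>. Smooth bump functions make global sections sufficient.\<close>

definition parallel_bundle ::
  "('m::topological_space, 'e::euclidean_space) chart set \<Rightarrow>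
   (('m \<Rightarrow> 'e) \<Rightarrow> ('m \<Rightarrow> 'e) \<Rightarrow> 'm \<Rightarrow> 'e) \<Rightarrow> ('m \<Rightarrow> ('e \<Rightarrow>\<^sub>L 'e) set) \<Rightarrow> bool" where
  "parallel_bundle A nabla \<sigma> \<longleftrightarrow>
     (\<forall>S X. smooth_endo A UNIV S \<and> (\<forall>x. S x \<in> \<sigma> x) \<and> vector_field A UNIV X \<longrightarrow>
        (\<exists>T. smooth_endo A UNIV T \<and> (\<forall>x. T x \<in> \<sigma> x) \<and>
           (\<forall>Y x. vector_field A UNIV Y \<longrightarrow>
              nabla X (\<lambda>y. blinfun_apply (S y) (Y y)) x - blinfun_apply (S x) (nabla X Y x) =
              blinfun_apply (T x) (Y x))))"


section \<open>Paraquaternionic structures\<close>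

text \<open>Indices modulo 3 are the elements of the type \<open>3\<close>, in which \<open>3 = 0\<close>.\<close>

definition eps :: "3 \<Rightarrow> real" where
  "eps \<alpha> = (if \<alpha> = 1 then 1 else -1)"

definition canonical_basis ::
  "('m::topological_space, 'e::euclidean_space) chart set \<Rightarrow> ('m \<Rightarrow> ('e \<Rightarrow>\<^sub>L 'e) set) \<Rightarrow>
   'm set \<Rightarrow> (3 \<Rightarrow> 'm \<Rightarrow> 'e \<Rightarrow>\<^sub>L 'e) \<Rightarrow> bool" where
  "canonical_basis A \<sigma> U J \<longleftrightarrow> open U \<and> (\<forall>\<alpha>. smooth_endo A U (J \<alpha>)) \<and>
     (\<forall>x\<in>U.
        inj (\<lambda>\<alpha>. J \<alpha> x) \<and> independent (range (\<lambda>\<alpha>. J \<alpha> x)) \<and> span (range (\<lambda>\<alpha>. J \<alpha> x)) = \<sigma> x \<and>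
        (\<forall>\<alpha>. J \<alpha> x o\<^sub>L J \<alpha> x = - (eps \<alpha> *\<^sub>R id_blinfun) \<and>
             J \<alpha> x o\<^sub>L J (\<alpha> + 1) x = - (J (\<alpha> + 1) x o\<^sub>L J \<alpha> x) \<and>
             J \<alpha> x o\<^sub>L J (\<alpha> + 1) x = eps (\<alpha> + 2) *\<^sub>R J (\<alpha> + 2) x))"

text \<open>\<open>SO(2,1)\<close> as the special orthogonal group of the form with matrix
  \<open>diag(\<epsilon>\<^sub>1, \<epsilon>\<^sub>2, \<epsilon>\<^sub>3)\<close>.\<close>

definition SO21 :: "(real^3^3) set" where
  "SO21 = {P. P ** (\<chi> i j. if i = j then eps i else 0) ** transpose P =
                (\<chi> i j. if i = j then eps i else 0) \<and> det P = 1}"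

definition almost_paraquaternionic ::
  "('m::topological_space, 'e::euclidean_space) chart set \<Rightarrow> ('m \<Rightarrow> ('e \<Rightarrow>\<^sub>L 'e) set) \<Rightarrow> bool" where
  "almost_paraquaternionic A \<sigma> \<longleftrightarrow>
     (\<forall>x. \<exists>U J. x \<in> U \<and> (\<exists>c\<in>A. U \<subseteq> fst c) \<and> canonical_basis A \<sigma> U J) \<and>
     (\<forall>U J U' J'. canonical_basis A \<sigma> U J \<and> canonical_basis A \<sigma> U' J' \<longrightarrow>
        (\<exists>P. (\<forall>\<alpha> \<beta>. smooth_fun A (U \<inter> U') (\<lambda>x. P x $ \<alpha> $ \<beta>)) \<and>
           (\<forall>x \<in> U \<inter> U'. P x \<in> SO21 \<and> (\<forall>\<alpha>. J' \<alpha> x = (\<Sum>\<beta>\<in>UNIV. P x $ \<alpha> $ \<beta> *\<^sub>R J \<beta> x)))))"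

definition almost_paraquaternionic_hermitian ::
  "('m::topological_space, 'e::euclidean_space) chart set \<Rightarrow> ('m \<Rightarrow> ('e \<Rightarrow>\<^sub>L 'e) set) \<Rightarrow>
   ('m \<Rightarrow> 'e \<Rightarrow> 'e \<Rightarrow> real) \<Rightarrow> bool" where
  "almost_paraquaternionic_hermitian A \<sigma> g \<longleftrightarrow> almost_paraquaternionic A \<sigma> \<and> semi_riemannian A g \<and>
     (\<forall>U J. canonical_basis A \<sigma> U J \<longrightarrow>
        (\<forall>x\<in>U. \<forall>\<alpha> u v. g x (blinfun_apply (J \<alpha> x) u) (blinfun_apply (J \<alpha> x) v) = eps \<alpha> * g x u v))"

definition paraquaternionic_kaehler ::
  "('m::{t2_space,second_countable_topology}, 'e::euclidean_space) chart set \<Rightarrow>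
   ('m \<Rightarrow> ('e \<Rightarrow>\<^sub>L 'e) set) \<Rightarrow> ('m \<Rightarrow> 'e \<Rightarrow> 'e \<Rightarrow> real) \<Rightarrow> bool" where
  "paraquaternionic_kaehler A \<sigma> g \<longleftrightarrow> smooth_manifold A \<and> almost_paraquaternionic_hermitian A \<sigma> g \<and>
     (\<exists>nabla. levi_civita A g nabla \<and> parallel_bundle A nabla \<sigma>)"


section \<open>Non-degenerate and paraquaternionic CR-submanifolds\<close>

text \<open>An immersed submanifold is given by an immersion \<open>f\<close>, so that \<open>x \<in> U \<inter> N\<close> reads \<open>f x \<in> U\<close>.
  Subspaces of the tangent space of \<open>N\<close> at \<open>x\<close> are sets of vectors of its model space; their
  counterparts tangent to \<open>M\<close> are their images under \<open>tmap B A f x\<close>.\<close>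

definition induced_metric ::
  "('n, 'f::euclidean_space) chart set \<Rightarrow> ('m, 'e::euclidean_space) chart set \<Rightarrow>
   ('n \<Rightarrow> 'm) \<Rightarrow> ('m \<Rightarrow> 'e \<Rightarrow> 'e \<Rightarrow> real) \<Rightarrow> 'n \<Rightarrow> 'f \<Rightarrow> 'f \<Rightarrow> real" where
  "induced_metric B A f g x u v = g (f x) (tmap B A f x u) (tmap B A f x v)"

definition nondegenerate_submanifold ::
  "('n::{t2_space,second_countable_topology}, 'f::euclidean_space) chart set \<Rightarrow>
   ('m::topological_space, 'e::euclidean_space) chart set \<Rightarrow>
   ('n \<Rightarrow> 'm) \<Rightarrow> ('m \<Rightarrow> 'e \<Rightarrow> 'e \<Rightarrow> real) \<Rightarrow> bool" where
  "nondegenerate_submanifold B A f g \<longleftrightarrow> smooth_manifold B \<and> immersion B A f \<and>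
     (\<forall>x. nondegenerate_on (induced_metric B A f g x) UNIV)"

definition normal_fibre ::
  "('n, 'f::euclidean_space) chart set \<Rightarrow> ('m, 'e::euclidean_space) chart set \<Rightarrow>
   ('n \<Rightarrow> 'm) \<Rightarrow> ('m \<Rightarrow> 'e \<Rightarrow> 'e \<Rightarrow> real) \<Rightarrow> 'n \<Rightarrow> 'e set" where
  "normal_fibre B A f g x = orth_in (g (f x)) UNIV (range (tmap B A f x))"

definition Dperp ::
  "('n, 'f::euclidean_space) chart set \<Rightarrow> ('m, 'e::euclidean_space) chart set \<Rightarrow>
   ('n \<Rightarrow> 'm) \<Rightarrow> ('m \<Rightarrow> 'e \<Rightarrow> 'e \<Rightarrow> real) \<Rightarrow> ('n \<Rightarrow> 'f set) \<Rightarrow> 'n \<Rightarrow> 'f set" where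
  "Dperp B A f g D x = orth_in (induced_metric B A f g x) UNIV (D x)"

definition paraquaternionic_CR ::
  "('n::{t2_space,second_countable_topology}, 'f::euclidean_space) chart set \<Rightarrow>
   ('m::topological_space, 'e::euclidean_space) chart set \<Rightarrow> ('n \<Rightarrow> 'm) \<Rightarrow>
   ('m \<Rightarrow> ('e \<Rightarrow>\<^sub>L 'e) set) \<Rightarrow> ('m \<Rightarrow> 'e \<Rightarrow> 'e \<Rightarrow> real) \<Rightarrow> ('n \<Rightarrow> 'f set) \<Rightarrow> bool" where
  "paraquaternionic_CR B A f \<sigma> g D \<longleftrightarrow> nondegenerate_submanifold B A f g \<and>
     (\<exists>r. distribution B r D) \<and> (\<forall>x. nondegenerate_on (induced_metric B A f g x) (D x)) \<and>
     (\<forall>U J x \<alpha>. canonical_basis A \<sigma> U J \<and> f x \<in> U \<longrightarrow>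
        blinfun_apply (J \<alpha> (f x)) ` tmap B A f x ` D x = tmap B A f x ` D x \<and>
        blinfun_apply (J \<alpha> (f x)) ` tmap B A f x ` Dperp B A f g D x \<subseteq> normal_fibre B A f g x)"

definition nu_sub ::
  "('n, 'f::euclidean_space) chart set \<Rightarrow> ('m, 'e::euclidean_space) chart set \<Rightarrow> ('n \<Rightarrow> 'm) \<Rightarrow>
   ('m \<Rightarrow> 'e \<Rightarrow> 'e \<Rightarrow> real) \<Rightarrow> ('n \<Rightarrow> 'f set) \<Rightarrow> (3 \<Rightarrow> 'm \<Rightarrow> 'e \<Rightarrow>\<^sub>L 'e) \<Rightarrow> 3 \<Rightarrow> 'n \<Rightarrow> 'e set" where
  "nu_sub B A f g D J \<alpha> x = blinfun_apply (J \<alpha> (f x)) ` tmap B A f x ` Dperp B A f g D x"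

definition direct_sum_of :: "'a::real_vector set \<Rightarrow> (3 \<Rightarrow> 'a set) \<Rightarrow> bool" where
  "direct_sum_of W S \<longleftrightarrow> W = {\<Sum>\<alpha>\<in>UNIV. w \<alpha> | w. \<forall>\<alpha>. w \<alpha> \<in> S \<alpha>} \<and>
     (\<forall>w. (\<forall>\<alpha>. w \<alpha> \<in> S \<alpha>) \<and> (\<Sum>\<alpha>\<in>UNIV. w \<alpha>) = 0 \<longrightarrow> (\<forall>\<alpha>. w \<alpha> = 0))"

text \<open>The space \<open>\<nu>\<^sup>\<bottom>\<close> at \<open>x\<close> is formed with some canonical local basis around \<open>f x\<close>; it does not
  depend on which one.\<close>

definition nu_perp ::
  "('n, 'f::euclidean_space) chart set \<Rightarrow> ('m::topological_space, 'e::euclidean_space) chart set \<Rightarrow>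
   ('n \<Rightarrow> 'm) \<Rightarrow> ('m \<Rightarrow> ('e \<Rightarrow>\<^sub>L 'e) set) \<Rightarrow> ('m \<Rightarrow> 'e \<Rightarrow> 'e \<Rightarrow> real) \<Rightarrow> ('n \<Rightarrow> 'f set) \<Rightarrow>
   'n \<Rightarrow> 'e set" where
  "nu_perp B A f \<sigma> g D x = (SOME W. \<exists>U J. canonical_basis A \<sigma> U J \<and> f x \<in> U \<and>
     direct_sum_of W (\<lambda>\<alpha>. nu_sub B A f g D J \<alpha> x))"

definition nu ::
  "('n, 'f::euclidean_space) chart set \<Rightarrow> ('m::topological_space, 'e::euclidean_space) chart set \<Rightarrow>
   ('n \<Rightarrow> 'm) \<Rightarrow> ('m \<Rightarrow> ('e \<Rightarrow>\<^sub>L 'e) set) \<Rightarrow> ('m \<Rightarrow> 'e \<Rightarrow> 'e \<Rightarrow> real) \<Rightarrow> ('n \<Rightarrow> 'f set) \<Rightarrow>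
   'n \<Rightarrow> 'e set" where
  "nu B A f \<sigma> g D x = orth_in (g (f x)) (normal_fibre B A f g x) (nu_perp B A f \<sigma> g D x)"

end

theory Submission
  imports Defs
begin

text \<open>On each tangent space the \<open>J\<^sub>\<alpha>\<close> are skew for \<open>g\<close>, and for \<open>\<alpha> \<noteq> \<beta>\<close> the product
  \<open>J\<^sub>\<alpha> J\<^sub>\<beta>\<close> is a multiple of the third one. Since \<open>J\<^sub>\<gamma>\<close> maps \<open>\<D>\<^sup>\<bottom>\<close> into the normal space, the
  \<open>\<nu>\<^sub>\<alpha>\<close> are mutually orthogonal, and \<open>J\<^sub>\<alpha>\<close> is an isometry up to sign from \<open>\<D>\<^sup>\<bottom>\<close> onto \<open>\<nu>\<^sub>\<alpha>\<close>. This gives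
  all pointwise claims, and a local orthogonal frame of \<open>\<D>\<^sup>\<bottom>\<close> yields one of \<open>\<nu>\<^sup>\<bottom>\<close> by applying the
  \<open>J\<^sub>\<alpha>\<close>. Such a frame is found by orthogonalising smooth extensions of an orthogonal basis at one
  point; in the indefinite case this works near that point because the squares of the basis vectors
  do not vanish there.\<close>


section \<open>Calculus of smooth maps\<close>

text \<open>The pointwise algebra is short; the subbundle claim is what shapes the proof. A tangent
  vector at \<open>x\<close> is recorded in a chart chosen separately for each point, and this
  choice may jump, so smoothness of a section is visible only after \<open>tcoord\<close>. Moreover,
  smoothness of \<open>g\<close> and of \<open>J \<alpha>\<close> is stated through their action on
  vector fields of M, whereas a section along \<open>f\<close> is not given as the restriction of
  such a field. The way out is to expand sections in the coordinate fields of a chart of M: the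
  coefficients are smooth on N, and whatever \<open>g\<close> and \<open>J \<alpha>\<close> do to
  coordinate fields can be pulled back along \<open>f\<close>. A further obstacle is that
  \<open>nu_perp\<close> picks its canonical basis anew at every point, with no coherence between
  neighbours. A smooth frame built from one fixed basis is a frame of \<open>nu_perp\<close> only
  because the space can be written in terms of \<sigma> alone.\<close>

lemma Ck_on_SucD: "Ck_on (Suc k) S f \<Longrightarrow> Ck_on k S f"
proof (induction k arbitrary: f)
  case 0
  then show ?case
    by (auto intro!: continuous_at_imp_continuous_on differentiable_imp_continuous_within)
qed auto

text \<open>The derivative at a point of \<open>S\<close> depends on values nearby; openness of
  \<open>S\<close> is what lets pointwise agreement pass to the derivatives in the
  induction.\<close>

lemma Ck_on_cong:
  assumes "open S" "\<And>x. x \<in> S \<Longrightarrow> f x = g x" "Ck_on k S f"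
  shows "Ck_on k S g"
  using assms(2,3)
proof (induction k arbitrary: f g)
  case 0
  then show ?case by (auto cong: continuous_on_cong)
next
  case (Suc k)
  have der: "(g has_derivative frechet_derivative f (at x)) (at x)" if "x \<in> S" for x
  proof (rule has_derivative_transform_within_open[OF _ \<open>open S\<close> that])
    show "(f has_derivative frechet_derivative f (at x)) (at x)"
      using Suc.prems that by (simp add: frechet_derivative_works)
  qed (use Suc.prems in auto)
  have "Ck_on k S (\<lambda>x. frechet_derivative g (at x) v)" for v
  proof (rule Suc.IH)
    show "frechet_derivative f (at x) v = frechet_derivative g (at x) v" if "x \<in> S" for x
      using frechet_derivative_at[OF der[OF that]] by simp
  qed (use Suc.prems in simp)
  moreover have "g differentiable (at x)" if "x \<in> S" for x
    using der[OF that] by (auto simp: differentiable_def)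
  ultimately show ?case by simp
qed

text \<open>Any explicit formula for the derivative may replace the chosen
  \<open>frechet_derivative\<close>; the closure properties below all supply one.\<close>

lemma Ck_on_Suc_has_derivativeI:
  assumes "open S" and der: "\<And>x. x \<in> S \<Longrightarrow> (f has_derivative f' x) (at x)"
    and Ck: "\<And>v. Ck_on k S (\<lambda>x. f' x v)"
  shows "Ck_on (Suc k) S f"
proof -
  have "Ck_on k S (\<lambda>x. frechet_derivative f (at x) v)" for v
    by (rule Ck_on_cong[OF \<open>open S\<close> _ Ck[of v]]) (simp add: frechet_derivative_at[OF der, symmetric])
  then show ?thesis using der by (auto simp: differentiable_def)
qed

lemma Ck_on_Suc_has_derivativeD:
  assumes "Ck_on (Suc k) S f" "x \<in> S"
  shows "(f has_derivative frechet_derivative f (at x)) (at x)"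
  using assms by (simp add: frechet_derivative_works)

lemma Ck_on_subset: "Ck_on k S f \<Longrightarrow> T \<subseteq> S \<Longrightarrow> Ck_on k T f"
  by (induction k arbitrary: f) (auto intro: continuous_on_subset)

lemma Ck_on_UN:
  assumes "\<And>i. i \<in> I \<Longrightarrow> open (S i)" "\<And>i. i \<in> I \<Longrightarrow> Ck_on k (S i) f"
  shows "Ck_on k (\<Union>i\<in>I. S i) f"
  using assms(2) by (induction k arbitrary: f) (auto intro!: continuous_on_open_UN assms(1))

lemma Ck_on_const: "open S \<Longrightarrow> Ck_on k S (\<lambda>_. c)"
proof (induction k arbitrary: c)
  case (Suc k)
  then show ?case
    by (intro Ck_on_Suc_has_derivativeI[of _ _ "\<lambda>_ _. 0"]) auto
qed auto

lemma Ck_on_bounded_linear: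
  assumes "bounded_linear L" "open S" "Ck_on k S f"
  shows "Ck_on k S (\<lambda>x. L (f x))"
  using assms(3)
proof (induction k arbitrary: f)
  case 0
  then show ?case using assms(1) by (auto intro: bounded_linear.continuous_on)
next
  case (Suc k)
  show ?case
  proof (rule Ck_on_Suc_has_derivativeI[OF \<open>open S\<close>])
    show "((\<lambda>x. L (f x)) has_derivative (\<lambda>v. L (frechet_derivative f (at x) v))) (at x)"
      if "x \<in> S" for x
      by (rule bounded_linear.has_derivative[OF assms(1) Ck_on_Suc_has_derivativeD[OF Suc.prems that]])
  qed (use Suc in simp)
qed

lemma Ck_on_add:
  assumes "open S" "Ck_on k S f" "Ck_on k S g"
  shows "Ck_on k S (\<lambda>x. f x + g x)"
  using assms(2,3)
proof (induction k arbitrary: f g)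
  case 0
  then show ?case by (auto intro: continuous_intros)
next
  case (Suc k)
  show ?case
  proof (rule Ck_on_Suc_has_derivativeI[OF \<open>open S\<close>])
    show "((\<lambda>x. f x + g x) has_derivative
        (\<lambda>v. frechet_derivative f (at x) v + frechet_derivative g (at x) v)) (at x)" if "x \<in> S" for x
      using Suc.prems that by (intro has_derivative_add Ck_on_Suc_has_derivativeD)
  qed (use Suc in simp)
qed

lemma Ck_on_sum:
  assumes "open S" "\<And>i. i \<in> I \<Longrightarrow> Ck_on k S (f i)"
  shows "Ck_on k S (\<lambda>x. \<Sum>i\<in>I. f i x)"
  using assms(2)
  by (induction I rule: infinite_finite_induct) (auto intro: Ck_on_const Ck_on_add assms(1))

lemma Ck_on_bounded_bilinear:
  assumes b: "bounded_bilinear b" and "open S" "Ck_on k S f" "Ck_on k S g"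
  shows "Ck_on k S (\<lambda>x. b (f x) (g x))"
  using assms(3,4)
proof (induction k arbitrary: f g)
  case 0
  then show ?case using b by (auto intro: bounded_bilinear.continuous_on)
next
  case (Suc k)
  show ?case
  proof (rule Ck_on_Suc_has_derivativeI[OF \<open>open S\<close>])
    show "((\<lambda>x. b (f x) (g x)) has_derivative (\<lambda>v. b (f x) (frechet_derivative g (at x) v) +
        b (frechet_derivative f (at x) v) (g x))) (at x)" if "x \<in> S" for x
      using Suc.prems that by (intro bounded_bilinear.FDERIV[OF b] Ck_on_Suc_has_derivativeD)
    show "Ck_on k S (\<lambda>x. b (f x) (frechet_derivative g (at x) v) +
        b (frechet_derivative f (at x) v) (g x))" for v
      using Suc.prems Suc.prems[THEN Ck_on_SucD] by (intro Ck_on_add \<open>open S\<close> Suc.IH) simp_all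
  qed
qed

lemma linear_basis_expansion:
  fixes L :: "'a::euclidean_space \<Rightarrow> 'b::real_vector"
  assumes "linear L"
  shows "L v = (\<Sum>i\<in>Basis. (v \<bullet> i) *\<^sub>R L i)"
proof -
  interpret linear L by fact
  show ?thesis by (subst euclidean_representation[symmetric, of v]) (simp add: sum scale)
qed

text \<open>The chain rule differentiates \<open>g\<close> in a direction that varies with
  \<open>x\<close>, while \<open>Ck_on\<close> controls only fixed directions. Expanding that
  direction in the basis leaves derivatives of \<open>g\<close> in fixed directions with scalar
  coefficients.\<close>

lemma Ck_on_compose:
  fixes f :: "'a::real_normed_vector \<Rightarrow> 'b::euclidean_space"
  assumes "open S" "open T" "f ` S \<subseteq> T" "Ck_on k S f" "Ck_on k T g"
  shows "Ck_on k S (\<lambda>x. g (f x))"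
  using assms(4,5)
proof (induction k arbitrary: g)
  case 0
  then show ?case using assms(3) by (auto intro: continuous_on_compose2)
next
  case (Suc k)
  let ?g = "\<lambda>y. frechet_derivative g (at y)" and ?f = "\<lambda>x. frechet_derivative f (at x)"
  have der: "(g has_derivative ?g (f x)) (at (f x))" if "x \<in> S" for x
    using Ck_on_Suc_has_derivativeD[OF Suc.prems(2)] that assms(3) by auto
  show ?case
  proof (rule Ck_on_Suc_has_derivativeI[OF \<open>open S\<close>])
    fix x assume x: "x \<in> S"
    have "((\<lambda>x. g (f x)) has_derivative (\<lambda>v. ?g (f x) (?f x v))) (at x)"
      using has_derivative_compose[OF Ck_on_Suc_has_derivativeD[OF Suc.prems(1) x] der[OF x]] .
    moreover have "(\<lambda>v. ?g (f x) (?f x v)) = (\<lambda>v. \<Sum>i\<in>Basis. (?f x v \<bullet> i) *\<^sub>R ?g (f x) i)"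
      by (rule ext, rule linear_basis_expansion, rule has_derivative_linear[OF der[OF x]])
    ultimately show "((\<lambda>x. g (f x)) has_derivative
        (\<lambda>v. \<Sum>i\<in>Basis. (?f x v \<bullet> i) *\<^sub>R ?g (f x) i)) (at x)"
      by metis
  next
    fix v
    show "Ck_on k S (\<lambda>x. \<Sum>i\<in>Basis. (?f x v \<bullet> i) *\<^sub>R ?g (f x) i)"
    proof (intro Ck_on_sum Ck_on_bounded_bilinear[OF bounded_bilinear_scaleR]
        Ck_on_bounded_linear[OF bounded_linear_inner_left] \<open>open S\<close>)
      show "Ck_on k S (\<lambda>x. ?f x v)" using Suc.prems(1) by simp
      show "Ck_on k S (\<lambda>x. ?g (f x) i)" for i
        using Suc.prems Ck_on_SucD by (intro Suc.IH) auto
    qed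
  qed
qed

section \<open>Maps smooth to all orders\<close>

lemma smooth_on_cong: "open S \<Longrightarrow> (\<And>x. x \<in> S \<Longrightarrow> f x = g x) \<Longrightarrow> smooth_on S f \<Longrightarrow> smooth_on S g"
  unfolding smooth_on_def by (blast intro: Ck_on_cong[of S f g])

lemma smooth_on_subset: "smooth_on S f \<Longrightarrow> T \<subseteq> S \<Longrightarrow> smooth_on T f"
  unfolding smooth_on_def by (auto intro: Ck_on_subset)

lemma smooth_on_UN:
  "(\<And>i. i \<in> I \<Longrightarrow> open (S i)) \<Longrightarrow> (\<And>i. i \<in> I \<Longrightarrow> smooth_on (S i) f) \<Longrightarrow> smooth_on (\<Union>i\<in>I. S i) f"
  unfolding smooth_on_def by (intro allI Ck_on_UN) auto

lemma smooth_on_const: "open S \<Longrightarrow> smooth_on S (\<lambda>_. c)"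
  unfolding smooth_on_def by (simp add: Ck_on_const)

lemma smooth_on_add:
  "open S \<Longrightarrow> smooth_on S f \<Longrightarrow> smooth_on S g \<Longrightarrow> smooth_on S (\<lambda>x. f x + g x)"
  unfolding smooth_on_def by (intro allI Ck_on_add) auto

lemma smooth_on_sum:
  "open S \<Longrightarrow> (\<And>i. i \<in> I \<Longrightarrow> smooth_on S (f i)) \<Longrightarrow> smooth_on S (\<lambda>x. \<Sum>i\<in>I. f i x)"
  unfolding smooth_on_def by (intro allI Ck_on_sum) auto

lemma smooth_on_scaleR:
  "open S \<Longrightarrow> smooth_on S f \<Longrightarrow> smooth_on S g \<Longrightarrow> smooth_on S (\<lambda>x. f x *\<^sub>R g x)"
  unfolding smooth_on_def by (intro allI Ck_on_bounded_bilinear[OF bounded_bilinear_scaleR]) auto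

lemma smooth_on_inner_left: "open S \<Longrightarrow> smooth_on S f \<Longrightarrow> smooth_on S (\<lambda>x. f x \<bullet> v)"
  unfolding smooth_on_def by (intro allI Ck_on_bounded_linear[OF bounded_linear_inner_left]) auto

lemma smooth_on_compose:
  fixes f :: "'a::real_normed_vector \<Rightarrow> 'b::euclidean_space"
  shows "\<lbrakk>open S; open T; f ` S \<subseteq> T; smooth_on S f; smooth_on T g\<rbrakk> \<Longrightarrow> smooth_on S (\<lambda>x. g (f x))"
  unfolding smooth_on_def by (auto intro: Ck_on_compose)

lemma smooth_on_has_derivative:
  "smooth_on S f \<Longrightarrow> x \<in> S \<Longrightarrow> (f has_derivative frechet_derivative f (at x)) (at x)"
  unfolding smooth_on_def by (rule Ck_on_Suc_has_derivativeD[of 0 S]) simp_all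

lemma smooth_on_frechet_derivative:
  "smooth_on S f \<Longrightarrow> smooth_on S (\<lambda>x. frechet_derivative f (at x) v)"
  unfolding smooth_on_def
  using Ck_on.simps(2) by blast

lemma smooth_on_continuous: "smooth_on S f \<Longrightarrow> continuous_on S f"
  unfolding smooth_on_def by (auto dest: spec[of _ 0])


section \<open>Orthogonal families for symmetric bilinear forms\<close>

locale symmetric_bilinear =
  fixes b :: "'a::euclidean_space \<Rightarrow> 'a \<Rightarrow> real"
  assumes bilinear: "bilinear b" and sym: "b u v = b v u"
begin

lemmas b_simps [simp] =
  bilinear_ladd[OF bilinear] bilinear_radd[OF bilinear]
  bilinear_lmul[OF bilinear] bilinear_rmul[OF bilinear]
  bilinear_lneg[OF bilinear] bilinear_rneg[OF bilinear]
  bilinear_lzero[OF bilinear] bilinear_rzero[OF bilinear]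
  bilinear_lsub[OF bilinear] bilinear_rsub[OF bilinear]

lemma linear_left: "linear (\<lambda>u. b u v)"
  using bilinear by (simp add: bilinear_def)

lemma b_sum_left: "b (\<Sum>i\<in>I. u i) v = (\<Sum>i\<in>I. b (u i) v)"
  using linear_sum[OF linear_left] .

lemma subspace_orth_in: "subspace W \<Longrightarrow> subspace (orth_in b W D)"
  by (auto simp: subspace_def orth_in_def)

lemma orth_to_span:
  assumes "\<And>v. v \<in> S \<Longrightarrow> b u v = 0" "v \<in> span S"
  shows "b u v = 0"
proof -
  have "linear (b u)" using bilinear by (simp add: bilinear_def)
  then show ?thesis using linear_eq_0_on_span assms by blast
qed

text \<open>Polarisation: if all squares on \<open>W\<close> vanish, expanding the square of
  \<open>w + v\<close> gives \<open>2 * b w v = 0\<close>, so every \<open>w\<close> in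
  \<open>W\<close> is degenerate.\<close>

lemma ex_anisotropic:
  assumes "subspace W" "nondegenerate_on b W" "W \<noteq> {0}"
  shows "\<exists>v\<in>W. b v v \<noteq> 0"
proof (rule ccontr)
  assume "\<not> ?thesis"
  then have iso: "b v v = 0" if "v \<in> W" for v using that by blast
  obtain w where w: "w \<in> W" "w \<noteq> 0" using assms(1,3) subspace_0 by blast
  have "b w v = 0" if "v \<in> W" for v
    using iso[OF w(1)] iso[OF that] iso[OF subspace_add[OF assms(1) w(1) that]] sym[of v w] by simp
  then show False using assms(2) w by (auto simp: nondegenerate_on_def)
qed

text \<open>Nonvanishing squares take the place of normalisation: the form may be indefinite, and
  null vectors are what has to be excluded.\<close>

definition orthogonal_family :: "nat \<Rightarrow> (nat \<Rightarrow> 'a) \<Rightarrow> bool" where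
  "orthogonal_family n e \<longleftrightarrow>
     (\<forall>i<n. b (e i) (e i) \<noteq> 0) \<and> (\<forall>i<n. \<forall>j<n. i \<noteq> j \<longrightarrow> b (e i) (e j) = 0)"

lemma orthogonal_family_inj: "orthogonal_family n e \<Longrightarrow> inj_on e {..<n}"
  by (rule inj_onI) (metis lessThan_iff orthogonal_family_def)

lemma orthogonal_family_independent:
  assumes "orthogonal_family n e"
  shows "independent (e ` {..<n})"
proof (rule independent_if_scalars_zero)
  fix c x assume sum: "(\<Sum>x\<in>e ` {..<n}. c x *\<^sub>R x) = 0" and "x \<in> e ` {..<n}"
  then obtain i where i: "i < n" "x = e i" by blast
  have "0 = b (\<Sum>j<n. c (e j) *\<^sub>R e j) (e i)"
    using sum by (simp add: sum.reindex[OF orthogonal_family_inj[OF assms]])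
  also have "\<dots> = (\<Sum>j<n. if j = i then c (e i) * b (e i) (e i) else 0)"
    unfolding b_sum_left
    by (intro sum.cong) (use assms i in \<open>auto simp: orthogonal_family_def\<close>)
  also have "\<dots> = c x * b (e i) (e i)" using i by simp
  finally show "c x = 0" using assms i by (auto simp: orthogonal_family_def)
qed simp

lemma orthogonal_family_card_le:
  assumes "orthogonal_family n e" "\<And>i. i < n \<Longrightarrow> e i \<in> W"
  shows "n \<le> dim W"
proof -
  have "card (e ` {..<n}) \<le> dim W"
    using assms by (intro independent_card_le_dim orthogonal_family_independent) auto
  then show ?thesis by (simp add: card_image[OF orthogonal_family_inj[OF assms(1)]])
qed

lemma orthogonal_family_span:
  assumes "orthogonal_family n e" "subspace W" "dim W = n" "\<And>i. i < n \<Longrightarrow> e i \<in> W"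
  shows "span (e ` {..<n}) = W"
proof
  show "span (e ` {..<n}) \<subseteq> W" using assms by (intro span_minimal) auto
  show "W \<subseteq> span (e ` {..<n})"
    using assms orthogonal_family_independent[OF assms(1)]
    by (intro card_ge_dim_independent) (auto simp: card_image[OF orthogonal_family_inj[OF assms(1)]])
qed

lemma dim_orth_singleton:
  assumes "subspace W" "v \<in> W" "b v v \<noteq> 0"
  shows "dim W = Suc (dim (orth_in b W {v}))"
proof -
  let ?W = "orth_in b W {v}"
  have "W \<subseteq> span (insert v ?W)"
  proof
    fix w assume "w \<in> W"
    then have "w - (b w v / b v v) *\<^sub>R v \<in> ?W"
      using assms by (auto simp: orth_in_def subspace_diff subspace_scale)
    then show "w \<in> span (insert v ?W)"
      by (metis diff_add_cancel insertCI span_add span_base span_scale)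
  qed
  moreover have "insert v ?W \<subseteq> W" using assms by (auto simp: orth_in_def)
  ultimately have "dim W = dim (insert v ?W)"
    by (metis dim_mono dim_span dim_subset le_antisym)
  moreover have "v \<notin> span ?W"
    unfolding span_eq_iff[THEN iffD2, OF subspace_orth_in[OF assms(1)]]
    using assms(3) by (simp add: orth_in_def)
  ultimately show ?thesis by (simp add: dim_insert)
qed

text \<open>The complement of a null vector contains that vector and is degenerate, so the induction
  splits off a vector with nonzero square. Its complement is nondegenerate again: a vector
  orthogonal to the complement and to \<open>v\<close> is orthogonal to all of
  \<open>W\<close>.\<close>

lemma ex_orthogonal_family:
  assumes "subspace W" "nondegenerate_on b W"
  shows "\<exists>e. orthogonal_family (dim W) e \<and> (\<forall>i<dim W. e i \<in> W)"
  using assms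
proof (induction "dim W" arbitrary: W)
  case 0
  then have "dim W = 0" by simp
  then show ?case by (simp only: orthogonal_family_def) simp
next
  case (Suc n)
  then have "W \<noteq> {0}" by (metis dim_eq_0 nat.distinct(1) order_refl)
  then obtain v where v: "v \<in> W" "b v v \<noteq> 0" using ex_anisotropic Suc.prems by blast
  let ?W = "orth_in b W {v}"
  have n: "n = dim ?W" using dim_orth_singleton[OF Suc.prems(1) v] Suc.hyps(2) by simp
  have "nondegenerate_on b ?W"
  proof (unfold nondegenerate_on_def, intro ballI impI)
    fix w assume w: "w \<in> ?W" "\<forall>u\<in>?W. b w u = 0"
    have "b w u = 0" if "u \<in> W" for u
    proof -
      have "u - (b u v / b v v) *\<^sub>R v \<in> ?W"
        using that v Suc.prems by (auto simp: orth_in_def subspace_diff subspace_scale)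
      then have "b w (u - (b u v / b v v) *\<^sub>R v) = 0" using w(2) by blast
      then show ?thesis using w(1) by (simp add: orth_in_def)
    qed
    then show "w = 0" using Suc.prems(2) w(1) by (auto simp: nondegenerate_on_def orth_in_def)
  qed
  then obtain e where e: "orthogonal_family n e" "\<forall>i<n. e i \<in> ?W"
    using Suc.hyps(1)[OF n] subspace_orth_in[OF Suc.prems(1)] n by auto
  let ?e = "\<lambda>i. if i < n then e i else v"
  have "orthogonal_family (Suc n) ?e"
    using e v sym by (auto simp: orthogonal_family_def orth_in_def less_Suc_eq)
  moreover have "\<forall>i<Suc n. ?e i \<in> W" using e v by (auto simp: orth_in_def)
  ultimately show ?case unfolding Suc.hyps(2)[symmetric] by (intro exI[of _ ?e] conjI)
qed

text \<open>Fourier expansion along an orthogonal basis of \<open>W\<close>; the squares in the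
  denominators may be negative but not zero.\<close>

lemma ex_orthogonal_projection:
  assumes "subspace W" "nondegenerate_on b W"
  shows "\<exists>w\<in>W. v - w \<in> orth_in b UNIV W"
proof -
  obtain e where e: "orthogonal_family (dim W) e" "\<forall>i<dim W. e i \<in> W"
    using ex_orthogonal_family[OF assms] by blast
  let ?w = "\<Sum>i<dim W. (b v (e i) / b (e i) (e i)) *\<^sub>R e i"
  have "b (v - ?w) (e i) = 0" if "i < dim W" for i
  proof -
    have "b ?w (e i) = (\<Sum>j<dim W. if j = i then b v (e i) else 0)"
      unfolding b_sum_left by (intro sum.cong) (use e that in \<open>auto simp: orthogonal_family_def\<close>)
    then show ?thesis using that by simp
  qed
  then have "b (v - ?w) u = 0" if "u \<in> span (e ` {..<dim W})" for u
    by (intro orth_to_span[OF _ that]) auto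
  then have "v - ?w \<in> orth_in b UNIV W"
    using orthogonal_family_span[OF e(1) assms(1)] e(2) by (auto simp: orth_in_def)
  moreover have "?w \<in> W"
    using e(2) assms(1) by (auto intro!: subspace_sum subspace_scale)
  ultimately show ?thesis by blast
qed

lemma orth_in_Int:
  "nondegenerate_on b W \<Longrightarrow> W \<inter> orth_in b UNIV W \<subseteq> {0}"
  by (auto simp: nondegenerate_on_def orth_in_def)

lemma dim_orth_in:
  assumes "subspace W" "nondegenerate_on b W"
  shows "dim W + dim (orth_in b UNIV W) = DIM('a)"
proof -
  let ?P = "orth_in b UNIV W"
  have "\<exists>x y. v = x + y \<and> x \<in> W \<and> y \<in> ?P" for v
    using ex_orthogonal_projection[OF assms, of v] by (metis add.commute diff_add_cancel)
  then have "{x + y |x y. x \<in> W \<and> y \<in> ?P} = UNIV" by blast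
  moreover have "dim (W \<inter> ?P) = 0"
    using orth_in_Int[OF assms(2)] by (simp only: dim_eq_0)
  ultimately show ?thesis
    using dim_sums_Int[OF assms(1) subspace_orth_in[OF subspace_UNIV], of W] by (simp only: dim_UNIV)
qed

lemma nondegenerate_orth_in:
  assumes "subspace W" "nondegenerate_on b W" "nondegenerate_on b UNIV"
  shows "nondegenerate_on b (orth_in b UNIV W)"
proof (unfold nondegenerate_on_def, intro ballI impI)
  fix w assume w: "w \<in> orth_in b UNIV W" "\<forall>u\<in>orth_in b UNIV W. b w u = 0"
  have "b w v = 0" for v
  proof -
    obtain u where u: "u \<in> W" "v - u \<in> orth_in b UNIV W"
      using ex_orthogonal_projection[OF assms(1,2)] by blast
    then have "b w (v - u) = 0" using w(2) by blast
    moreover have "b w u = 0" using w(1) u(1) by (simp add: orth_in_def)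
    ultimately show ?thesis by simp
  qed
  then show "w = 0" using assms(3) by (auto simp: nondegenerate_on_def)
qed

end

text \<open>The summands determine their direct sum. This is what later removes the ambiguity from
  the choice in \<open>nu_perp\<close>.\<close>

lemma direct_sum_of_span:
  assumes "direct_sum_of W S" "\<And>\<alpha>. subspace (S \<alpha>)"
  shows "W = span (\<Union>\<alpha>. S \<alpha>)"
proof -
  have W: "W = {\<Sum>\<alpha>\<in>UNIV. w \<alpha> | w. \<forall>\<alpha>. w \<alpha> \<in> S \<alpha>}"
    using assms(1) by (simp add: direct_sum_of_def)
  have "W \<subseteq> span (\<Union>\<alpha>. S \<alpha>)"
    unfolding W by (auto intro!: span_sum intro: span_base)
  moreover have "span (\<Union>\<alpha>. S \<alpha>) \<subseteq> W"
  proof (rule span_minimal)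
    show "(\<Union>\<alpha>. S \<alpha>) \<subseteq> W"
    proof
      fix v assume "v \<in> (\<Union>\<alpha>. S \<alpha>)"
      then obtain \<alpha> where "v \<in> S \<alpha>" by blast
      then show "v \<in> W" unfolding W using subspace_0[OF assms(2)]
        by (auto intro!: exI[of _ "\<lambda>\<beta>. if \<beta> = \<alpha> then v else 0"])
    qed
    show "subspace W"
    proof (rule subspaceI)
      show "0 \<in> W" unfolding W using subspace_0[OF assms(2)] by (auto intro!: exI[of _ "\<lambda>_. 0"])
      fix x y :: 'a and c :: real
      assume "x \<in> W"
      then obtain u where u: "x = sum u UNIV" "\<forall>\<alpha>. u \<alpha> \<in> S \<alpha>" unfolding W by auto
      then show "c *\<^sub>R x \<in> W" unfolding W using subspace_scale[OF assms(2)]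
        by (auto intro!: exI[of _ "\<lambda>\<alpha>. c *\<^sub>R u \<alpha>"] simp: scaleR_sum_right)
      assume "y \<in> W"
      then obtain v where "y = sum v UNIV" "\<forall>\<alpha>. v \<alpha> \<in> S \<alpha>" unfolding W by auto
      then show "x + y \<in> W" unfolding W using u subspace_add[OF assms(2)]
        by (auto intro!: exI[of _ "\<lambda>\<alpha>. u \<alpha> + v \<alpha>"] simp: sum.distrib)
    qed
  qed
  ultimately show ?thesis by blast
qed

lemma direct_sum_of_span_Union:
  assumes "\<And>\<alpha>. subspace (S \<alpha>)"
    "\<And>w. \<lbrakk>\<forall>\<alpha>. w \<alpha> \<in> S \<alpha>; (\<Sum>\<alpha>\<in>UNIV. w \<alpha>) = 0\<rbrakk> \<Longrightarrow> \<forall>\<alpha>. w \<alpha> = 0"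
  shows "direct_sum_of (span (\<Union>\<alpha>. S \<alpha>)) S"
proof -
  have sum: "direct_sum_of {\<Sum>\<alpha>\<in>UNIV. w \<alpha> | w. \<forall>\<alpha>. w \<alpha> \<in> S \<alpha>} S"
    using assms(2) by (simp add: direct_sum_of_def)
  show ?thesis using sum unfolding direct_sum_of_span[OF sum assms(1), symmetric] .
qed

section \<open>Signs and index arithmetic modulo 3\<close>

lemma eps_mult_self [simp]: "eps \<alpha> * eps \<alpha> = 1"
  by (simp add: eps_def)

lemma eps_nonzero [simp]: "eps \<alpha> \<noteq> 0"
  by (simp add: eps_def)

lemma neq_3_cases: "(\<alpha>::3) \<noteq> \<beta> \<Longrightarrow> \<beta> = \<alpha> + 1 \<or> \<alpha> = \<beta> + 1"
  using exhaust_3[of \<alpha>] exhaust_3[of \<beta>] by auto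

text \<open>Of the six permutations of three points the three transpositions are odd, and what
  remains are the rotations.\<close>

lemma even_permutation_3:
  assumes "p permutes (UNIV :: 3 set)" "evenperm p"
  shows "p 2 = p 1 + 1" "p 3 = p 1 + 2"
proof -
  have inj: "inj p" using assms(1) permutes_inj by blast
  have odd: "p \<noteq> Transposition.transpose a c" if "a \<noteq> c" for a c
    using assms(2) evenperm_swap[of a c] that by auto
  have "p 2 = p 1 + 1 \<and> p 3 = p 1 + 2"
    using exhaust_3[of "p 1"] exhaust_3[of "p 2"] exhaust_3[of "p 3"]
      odd[of 1 2] odd[of 1 3] odd[of 2 3] inj_eq[OF inj, of 1 2] inj_eq[OF inj, of 1 3]
      inj_eq[OF inj, of 2 3]
    by (auto simp: fun_eq_iff forall_3 Transposition.transpose_def)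
  then show "p 2 = p 1 + 1" "p 3 = p 1 + 2" by auto
qed


section \<open>Paraquaternionic linear algebra\<close>

text \<open>The residues 0, 1, 2 name the three indices, with 0 standing for 3; this allows a frame
  to be numbered through \<open>i mod 3\<close>.\<close>

lemma of_nat_3_eq: "k < 3 \<Longrightarrow> l < 3 \<Longrightarrow> (of_nat k :: 3) = of_nat l \<Longrightarrow> k = l"
proof -
  assume "k < 3" "l < 3" "(of_nat k :: 3) = of_nat l"
  moreover from this have "k \<in> {0, 1, 2}" "l \<in> {0, 1, 2}" by auto
  ultimately show ?thesis by auto
qed

text \<open>The situation in a single tangent space: \<open>W\<close> and \<open>P\<close> stand for the images in \<open>TM\<close> of
  \<open>\<D>\<^sub>x\<close> and \<open>\<D>\<^sup>\<bottom>\<^sub>x\<close>, and \<open>N\<close>, \<open>Q\<close> below for the normal space and for \<open>\<nu>\<^sup>\<bottom>\<^sub>x\<close>.\<close>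

locale CR_point = symmetric_bilinear b for b :: "'a::euclidean_space \<Rightarrow> 'a \<Rightarrow> real" +
  fixes J :: "3 \<Rightarrow> 'a \<Rightarrow> 'a" and W P :: "'a set"
  assumes linear_J: "linear (J \<alpha>)"
    and J_square: "J \<alpha> (J \<alpha> v) = - eps \<alpha> *\<^sub>R v"
    and J_succ: "J \<alpha> (J (\<alpha> + 1) v) = eps (\<alpha> + 2) *\<^sub>R J (\<alpha> + 2) v"
    and J_succ_left: "J (\<alpha> + 1) (J \<alpha> v) = - eps (\<alpha> + 2) *\<^sub>R J (\<alpha> + 2) v"
    and hermitian: "b (J \<alpha> u) (J \<alpha> v) = eps \<alpha> * b u v"
    and subspace_P: "subspace P"
    and J_W: "J \<alpha> ` W = W"
    and J_P_W: "u \<in> P \<Longrightarrow> w \<in> W \<Longrightarrow> b (J \<alpha> u) w = 0"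
    and J_P_P: "u \<in> P \<Longrightarrow> v \<in> P \<Longrightarrow> b (J \<alpha> u) v = 0"
    and nondegenerate_P: "nondegenerate_on b P"
begin

lemma J_scale: "J \<alpha> (c *\<^sub>R v) = c *\<^sub>R J \<alpha> v"
  by (rule linear_scale[OF linear_J])

text \<open>The sign in \<open>hermitian\<close> and the one in \<open>J_square\<close> cancel, so
  the complex structure and the two product structures are skew alike.\<close>

lemma J_skew: "b (J \<alpha> u) v = - b u (J \<alpha> v)"
proof -
  have "eps \<alpha> * b u (J \<alpha> v) = b (J \<alpha> u) (J \<alpha> (J \<alpha> v))" by (simp only: hermitian)
  also have "\<dots> = eps \<alpha> * (- b (J \<alpha> u) v)" by (simp add: J_square)
  finally have "eps \<alpha> * (b (J \<alpha> u) v + b u (J \<alpha> v)) = 0" by (simp add: distrib_left)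
  then show ?thesis by simp
qed

text \<open>Orthogonality arguments see neither the sign nor which index comes out, so both orders
  of the factors can be treated together.\<close>

lemma J_J:
  assumes "\<alpha> \<noteq> \<beta>"
  shows "\<exists>\<gamma> c. c \<noteq> 0 \<and> (\<forall>v. J \<alpha> (J \<beta> v) = c *\<^sub>R J \<gamma> v)"
  using neq_3_cases[OF assms]
proof
  assume "\<beta> = \<alpha> + 1"
  then show ?thesis using J_succ by (intro exI[of _ "\<alpha> + 2"] exI[of _ "eps (\<alpha> + 2)"]) simp
next
  assume "\<alpha> = \<beta> + 1"
  then show ?thesis using J_succ_left by (intro exI[of _ "\<beta> + 2"] exI[of _ "- eps (\<beta> + 2)"]) simp
qed

lemma subspace_J_P: "subspace (J \<alpha> ` P)"
  using linear_subspace_image[OF linear_J subspace_P] .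

lemma scale_P: "c \<noteq> 0 \<Longrightarrow> (\<lambda>v. c *\<^sub>R J \<alpha> v) ` P = J \<alpha> ` P"
proof -
  assume c: "c \<noteq> 0"
  have "c *\<^sub>R J \<alpha> v \<in> J \<alpha> ` P" if "v \<in> P" for v
    using subspace_scale[OF subspace_J_P] that by blast
  moreover have "J \<alpha> v \<in> (\<lambda>v. c *\<^sub>R J \<alpha> v) ` P" if "v \<in> P" for v
  proof (rule image_eqI)
    show "J \<alpha> v = c *\<^sub>R J \<alpha> ((1 / c) *\<^sub>R v)" using c by (simp add: J_scale)
  qed (rule subspace_scale[OF subspace_P that])
  ultimately show ?thesis by blast
qed

lemma J_J_P: "J \<alpha> ` J \<alpha> ` P = P"
proof -
  have "J \<alpha> (J \<alpha> v) \<in> P" if "v \<in> P" for v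
    unfolding J_square by (rule subspace_scale[OF subspace_P that])
  moreover have "v \<in> J \<alpha> ` J \<alpha> ` P" if "v \<in> P" for v
  proof (intro image_eqI)
    show "v = J \<alpha> (J \<alpha> (- eps \<alpha> *\<^sub>R v))" unfolding J_square by simp
    show "- eps \<alpha> *\<^sub>R v \<in> P" by (rule subspace_scale[OF subspace_P that])
  qed auto
  ultimately show ?thesis by blast
qed

lemma J_succ_P: "J \<alpha> ` J (\<alpha> + 1) ` P = J (\<alpha> + 2) ` P"
  using scale_P[of "eps (\<alpha> + 2)" "\<alpha> + 2"] by (simp add: image_image J_succ)

lemma J_P_orthogonal:
  assumes "\<alpha> \<noteq> \<beta>" "u \<in> J \<alpha> ` P" "v \<in> J \<beta> ` P"
  shows "b u v = 0"
proof -
  obtain p q where pq: "p \<in> P" "q \<in> P" "u = J \<alpha> p" "v = J \<beta> q" using assms by blast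
  obtain \<gamma> c where "\<forall>v. J \<alpha> (J \<beta> v) = c *\<^sub>R J \<gamma> v" using J_J[OF assms(1)] by blast
  then show ?thesis using J_P_P[OF pq(2,1), of \<gamma>] pq by (simp add: J_skew[of \<alpha>] sym[of p])
qed

lemma J_P_eq_0:
  assumes "v \<in> J \<alpha> ` P" "\<And>u. u \<in> J \<alpha> ` P \<Longrightarrow> b v u = 0"
  shows "v = 0"
proof -
  obtain p where p: "p \<in> P" "v = J \<alpha> p" using assms(1) by blast
  have "b p q = 0" if "q \<in> P" for q
    using assms(2)[of "J \<alpha> q"] that p(2) by (simp add: hermitian)
  then show ?thesis using nondegenerate_P p linear_0[OF linear_J]
    by (auto simp: nondegenerate_on_def)
qed

abbreviation "Q \<equiv> span (\<Union>\<alpha>. J \<alpha> ` P)"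

abbreviation "N \<equiv> orth_in b UNIV (W \<union> P)"

lemma sum_split: "(\<Sum>\<beta>\<in>UNIV. w \<beta>) = w \<alpha> + (\<Sum>\<beta>\<in>UNIV - {\<alpha>}. w (\<beta>::3))" for w :: "3 \<Rightarrow> 'a"
  by (simp add: sum.remove)

text \<open>Pairing with a vector of one summand isolates the component in that summand. With
  \<open>J_P_eq_0\<close> this yields both directness of the sum and nondegeneracy of
  \<open>Q\<close>.\<close>

lemma b_sum_J_P:
  assumes "\<forall>\<alpha>. w \<alpha> \<in> J \<alpha> ` P" "v \<in> J \<alpha> ` P"
  shows "b (\<Sum>\<beta>\<in>UNIV. w \<beta>) v = b (w \<alpha>) v"
proof -
  have "b (\<Sum>\<beta>\<in>UNIV - {\<alpha>}. w \<beta>) v = 0"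
    unfolding b_sum_left using assms J_P_orthogonal by (intro sum.neutral) blast
  then show ?thesis by (simp add: sum_split[of w \<alpha>])
qed

lemma direct_sum: "direct_sum_of Q (\<lambda>\<alpha>. J \<alpha> ` P)"
proof (rule direct_sum_of_span_Union[OF subspace_J_P])
  fix w assume w: "\<forall>\<alpha>. w \<alpha> \<in> J \<alpha> ` P" "(\<Sum>\<alpha>\<in>UNIV. w \<alpha>) = 0"
  show "\<forall>\<alpha>. w \<alpha> = 0"
  proof
    fix \<alpha>
    have "b (w \<alpha>) v = 0" if "v \<in> J \<alpha> ` P" for v
      using b_sum_J_P[OF w(1) that] w(2) by simp
    with w(1) show "w \<alpha> = 0" by (intro J_P_eq_0[of _ \<alpha>]) simp_all
  qed
qed

lemma Q_subset_N: "Q \<subseteq> N"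
  using J_P_W J_P_P by (intro span_minimal subspace_orth_in subspace_UNIV) (auto simp: orth_in_def)

lemma Q_nondegenerate: "nondegenerate_on b Q"
proof (unfold nondegenerate_on_def, intro ballI impI)
  fix q assume q: "q \<in> Q" "\<forall>v\<in>Q. b q v = 0"
  then obtain w where w: "q = sum w UNIV" "\<forall>\<alpha>. w \<alpha> \<in> J \<alpha> ` P"
    using direct_sum unfolding direct_sum_of_def by blast
  have "w \<alpha> = 0" for \<alpha>
  proof -
    have "b (w \<alpha>) v = 0" if v: "v \<in> J \<alpha> ` P" for v
    proof -
      have "v \<in> Q" using v by (blast intro: span_base)
      then show ?thesis using b_sum_J_P[OF w(2) v] q(2) w(1) by simp
    qed
    with w(2) show ?thesis by (intro J_P_eq_0[of _ \<alpha>]) simp_all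
  qed
  then show "q = 0" using w(1) by simp
qed

text \<open>The quotient \<open>i div 3\<close> selects the vector and the remainder
  \<open>i mod 3\<close> the structure. For equal remainders orthogonality comes from the family
  \<open>e\<close>; for different ones from \<open>J_P_orthogonal\<close>, even when the vector is
  the same.\<close>

lemma orthogonal_family_J:
  assumes "orthogonal_family s e" "\<And>i. i < s \<Longrightarrow> e i \<in> P"
  shows "orthogonal_family (3 * s) (\<lambda>i. J (of_nat (i mod 3)) (e (i div 3)))"
proof -
  have "b (J (of_nat (i mod 3)) (e (i div 3))) (J (of_nat (j mod 3)) (e (j div 3))) = 0"
    if ij: "i < 3 * s" "j < 3 * s" "i \<noteq> j" for i j
  proof (cases "i mod 3 = j mod 3")
    case True
    then have "i div 3 \<noteq> j div 3" using ij(3) by (metis div_mult_mod_eq)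
    then show ?thesis using assms(1) ij True by (simp add: hermitian orthogonal_family_def less_mult_imp_div_less mult.commute)
  next
    case False
    have "i mod 3 < 3" "j mod 3 < 3" by simp_all
    then have "(of_nat (i mod 3) :: 3) \<noteq> of_nat (j mod 3)"
      using False of_nat_3_eq by blast
    then show ?thesis using ij assms(2)
      by (intro J_P_orthogonal) (auto simp: less_mult_imp_div_less mult.commute)
  qed
  moreover have "b (J (of_nat (i mod 3)) (e (i div 3))) (J (of_nat (i mod 3)) (e (i div 3))) \<noteq> 0"
    if "i < 3 * s" for i
    using assms(1) that by (simp add: hermitian orthogonal_family_def less_mult_imp_div_less mult.commute)
  ultimately show ?thesis by (simp add: orthogonal_family_def)
qed

text \<open>The lower bound counts an orthogonal family inside \<open>Q\<close>, the upper bound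
  counts the generators \<open>J \<alpha> (e i)\<close>.\<close>

lemma dim_Q: "dim Q = 3 * dim P"
proof -
  obtain e where e: "orthogonal_family (dim P) e" "\<forall>i<dim P. e i \<in> P"
    using ex_orthogonal_family[OF subspace_P nondegenerate_P] by blast
  have "3 * dim P \<le> dim Q"
  proof (rule orthogonal_family_card_le[OF orthogonal_family_J[OF e(1)]])
    show "J (of_nat (i mod 3)) (e (i div 3)) \<in> Q" if "i < 3 * dim P" for i
      using e(2) that by (intro span_base UN_I[of "of_nat (i mod 3)"])
        (auto simp: less_mult_imp_div_less mult.commute)
  qed (use e(2) in blast)
  moreover have "dim Q \<le> 3 * dim P"
  proof -
    have Q: "Q = span (\<Union>\<alpha>. J \<alpha> ` (e ` {..<dim P}))"
    proof (rule antisym)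
      have "J \<alpha> ` P \<subseteq> span (\<Union>\<alpha>. J \<alpha> ` (e ` {..<dim P}))" for \<alpha>
      proof -
        have "J \<alpha> ` P = span (J \<alpha> ` e ` {..<dim P})"
          using orthogonal_family_span[OF e(1) subspace_P] e(2)
          by (simp add: linear_span_image[OF linear_J])
        also have "\<dots> \<subseteq> span (\<Union>\<alpha>. J \<alpha> ` (e ` {..<dim P}))" by (rule span_mono) blast
        finally show ?thesis .
      qed
      then show "Q \<subseteq> span (\<Union>\<alpha>. J \<alpha> ` (e ` {..<dim P}))"
        by (intro span_minimal) auto
      show "span (\<Union>\<alpha>. J \<alpha> ` (e ` {..<dim P})) \<subseteq> Q"
        using e(2) by (intro span_mono) auto
    qed
    have "dim Q \<le> card (\<Union>\<alpha>\<in>UNIV. J \<alpha> ` (e ` {..<dim P}))"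
      unfolding Q dim_span by (intro dim_le_card') simp
    also have "\<dots> \<le> (\<Sum>\<alpha>\<in>UNIV. card (J \<alpha> ` e ` {..<dim P}))"
      by (rule card_UN_le) simp
    also have "\<dots> \<le> (\<Sum>\<alpha>\<in>(UNIV::3 set). dim P)"
      by (rule sum_mono) (metis card_image_le card_lessThan finite_imageI finite_lessThan le_trans)
    finally show ?thesis by simp
  qed
  ultimately show ?thesis by simp
qed

text \<open>The space in question is the orthogonal complement of \<open>W\<close>, \<open>P\<close>
  and all \<open>J \<beta>\<close> P\<open>together. By skewness it is enough that\<close>J
  \<alpha>\<open>permutes these pieces among themselves:\<close>W\<open>is invariant,\<close>P\<open>is exchanged with\<close>J
  \<alpha> \<open>P\<close>, and the other two images of \<open>P\<close> are exchanged.\<close>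

lemma J_nu: "J \<alpha> ` orth_in b N Q = orth_in b N Q"
proof -
  have sub: "J \<alpha> v \<in> orth_in b N Q" if v: "v \<in> orth_in b N Q" for v
  proof -
    have vW: "b v w = 0" if "w \<in> W \<union> P" for w using v that by (auto simp: orth_in_def)
    have vJ: "b v (J \<beta> p) = 0" if "p \<in> P" for p \<beta>
    proof -
      have "J \<beta> p \<in> Q" using that by (intro span_base) blast
      then show ?thesis using v by (auto simp: orth_in_def)
    qed
    have "b (J \<alpha> v) w = 0" if "w \<in> W" for w
      using J_W[of \<alpha>] vW that by (auto simp: J_skew)
    moreover have "b (J \<alpha> v) p = 0" if "p \<in> P" for p
      using vJ that by (simp add: J_skew)
    moreover have "b (J \<alpha> v) (J \<beta> p) = 0" if "p \<in> P" for p \<beta>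
    proof (cases "\<alpha> = \<beta>")
      case True
      then show ?thesis using vW that by (simp add: hermitian)
    next
      case False
      then show ?thesis using J_J[OF False] vJ[OF that] by (auto simp: J_skew)
    qed
    then have "b (J \<alpha> v) q = 0" if "q \<in> Q" for q
      by (intro orth_to_span[OF _ that]) blast
    ultimately show ?thesis by (auto simp: orth_in_def)
  qed
  moreover have "orth_in b N Q \<subseteq> J \<alpha> ` orth_in b N Q"
  proof
    fix v assume v: "v \<in> orth_in b N Q"
    \<comment> \<open>Up to the sign \<open>- eps \<alpha>\<close>, the map
      \<open>J \<alpha>\<close> is its own inverse.\<close>
    have "v = J \<alpha> (- eps \<alpha> *\<^sub>R J \<alpha> v)" unfolding J_scale J_square by simp
    moreover have "- eps \<alpha> *\<^sub>R J \<alpha> v \<in> orth_in b N Q"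
      using sub[OF v] by (intro subspace_scale subspace_orth_in subspace_UNIV)
    ultimately show "v \<in> J \<alpha> ` orth_in b N Q" by (rule image_eqI)
  qed
  ultimately show ?thesis by blast
qed

end


section \<open>Smooth sections along a map\<close>

text \<open>Common generalisation of \<open>tcoord\<close> and \<open>tmap\<close> to arbitrary
  pairs of charts, so that a single chain rule covers every change of coordinates.\<close>

definition chart_deriv ::
  "('n, 'f::euclidean_space) chart \<Rightarrow> ('m, 'e::euclidean_space) chart \<Rightarrow> ('n \<Rightarrow> 'm) \<Rightarrow> 'n \<Rightarrow> 'f \<Rightarrow> 'e"
  where "chart_deriv c d f x = frechet_derivative (snd d \<circ> f \<circ> chart_inv c) (at (snd c x))"

lemma tcoord_eq_chart_deriv: "tcoord A c x = chart_deriv (chart_at A x) c id x"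
  by (simp add: tcoord_def chart_deriv_def)

lemma tmap_eq_chart_deriv: "tmap B A f x = chart_deriv (chart_at B x) (chart_at A (f x)) f x"
  by (simp add: tmap_def chart_deriv_def)

lemma smooth_section_along_iff:
  "smooth_section_along B A f V X \<longleftrightarrow> (\<forall>c\<in>B. \<forall>d\<in>A. smooth_on (snd c ` (V \<inter> fst c \<inter> f -` fst d))
     (\<lambda>z. tcoord A d (f (chart_inv c z)) (X (chart_inv c z))))"
  by (simp add: smooth_section_along_def comp_def)

lemma smooth_fun_iff:
  "smooth_fun A V h \<longleftrightarrow> (\<forall>c\<in>A. smooth_on (snd c ` (V \<inter> fst c)) (\<lambda>z. h (chart_inv c z)))"
  by (simp add: smooth_fun_def comp_def)

lemma vector_field_iff:
  "vector_field A V X \<longleftrightarrow> (\<forall>c\<in>A. \<forall>d\<in>A. smooth_on (snd c ` (V \<inter> fst c \<inter> fst d))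
     (\<lambda>z. tcoord A d (chart_inv c z) (X (chart_inv c z))))"
  by (simp add: vector_field_def smooth_section_along_iff)

lemma smooth_section_along_restrict:
  "smooth_section_along B A f V X \<Longrightarrow> W \<subseteq> V \<Longrightarrow> smooth_section_along B A f W X"
  unfolding smooth_section_along_iff by (blast intro: smooth_on_subset)

lemma vector_field_restrict: "vector_field A V X \<Longrightarrow> W \<subseteq> V \<Longrightarrow> vector_field A W X"
  unfolding vector_field_def by (rule smooth_section_along_restrict)

section \<open>Charts of a manifold\<close>

context
  fixes A :: "('m::{t2_space,second_countable_topology}, 'e::euclidean_space) chart set"
  assumes A: "smooth_manifold A"
begin

lemma ex_chart: "\<exists>c\<in>A. x \<in> fst c"
  using A unfolding smooth_manifold_def by blast

lemma chart_at: "chart_at A x \<in> A" "x \<in> fst (chart_at A x)"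
proof -
  have "\<exists>c. c \<in> A \<and> x \<in> fst c" using ex_chart by blast
  then show "chart_at A x \<in> A" "x \<in> fst (chart_at A x)"
    unfolding chart_at_def by (metis (mono_tags, lifting) someI_ex)+
qed

lemma chart_homeomorphism:
  "c \<in> A \<Longrightarrow> homeomorphism (fst c) (snd c ` fst c) (snd c) (chart_inv c)"
  using A by (simp add: smooth_manifold_def)

lemma open_chart_dom: "c \<in> A \<Longrightarrow> open (fst c)"
  using A by (simp add: smooth_manifold_def)

lemma chart_inv_chart: "c \<in> A \<Longrightarrow> x \<in> fst c \<Longrightarrow> chart_inv c (snd c x) = x"
  using chart_homeomorphism by (simp add: homeomorphism_def)

lemma open_chart_image:
  assumes "c \<in> A" "open V"
  shows "open (snd c ` (V \<inter> fst c))"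
proof -
  have "openin (top_of_set (snd c ` fst c)) (snd c ` (V \<inter> fst c))"
    using openin_open_Int[OF assms(2), of "fst c"]
    by (intro homeomorphism_imp_open_map[OF chart_homeomorphism[OF assms(1)]]) (simp add: Int_commute)
  moreover have "open (snd c ` fst c)" using A assms(1) by (simp add: smooth_manifold_def)
  ultimately show ?thesis using openin_open_eq by blast
qed

lemma smooth_map_id: "smooth_map A A id"
  using A by (auto simp: smooth_map_def smooth_manifold_def)

lemma smooth_fun_const: "open V \<Longrightarrow> smooth_fun A V (\<lambda>_. k)"
  using open_chart_image by (auto simp: smooth_fun_iff o_def intro: smooth_on_const)

lemma smooth_fun_continuous:
  assumes "open V" "smooth_fun A V h"
  shows "continuous_on V h"
proof -
  have "continuous_on (V \<inter> fst c) h" if c: "c \<in> A" for c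
  proof -
    have "continuous_on (V \<inter> fst c) (\<lambda>x. h (chart_inv c (snd c x)))"
    proof (rule continuous_on_compose2[of _ "\<lambda>z. h (chart_inv c z)"])
      show "continuous_on (snd c ` (V \<inter> fst c)) (\<lambda>z. h (chart_inv c z))"
        using assms(2) c by (intro smooth_on_continuous) (simp add: smooth_fun_iff)
      show "continuous_on (V \<inter> fst c) (snd c)"
        using chart_homeomorphism[OF c] by (auto simp: homeomorphism_def intro: continuous_on_subset)
    qed simp
    then show ?thesis
      by (rule continuous_on_cong[THEN iffD1, rotated -1]) (simp_all add: chart_inv_chart[OF c])
  qed
  then have "continuous_on (\<Union>c\<in>A. V \<inter> fst c) h"
    using assms(1) open_chart_dom by (intro continuous_on_open_UN) auto
  moreover have "(\<Union>c\<in>A. V \<inter> fst c) = V" using ex_chart by blast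
  ultimately show ?thesis by simp
qed

end

text \<open>Used with an immersion for sections along the submanifold and with \<open>id\<close> for
  vector fields on one manifold, so that both share one calculus.\<close>

locale manifold_map =
  fixes B :: "('n::{t2_space,second_countable_topology}, 'f::euclidean_space) chart set"
    and A :: "('m::{t2_space,second_countable_topology}, 'e::euclidean_space) chart set"
    and f :: "'n \<Rightarrow> 'm"
  assumes B: "smooth_manifold B" and A: "smooth_manifold A" and smooth_map: "smooth_map B A f"
begin

lemma open_vimage: "open U \<Longrightarrow> open (f -` U)"
  using smooth_map by (simp add: smooth_map_def continuous_on_open_vimage)

lemma open_dom:
  assumes "open V" "c \<in> B" "d \<in> A"
  shows "open (snd c ` (V \<inter> fst c \<inter> f -` fst d))"
proof -
  have "V \<inter> fst c \<inter> f -` fst d = (V \<inter> f -` fst d) \<inter> fst c" by blast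
  then show ?thesis
    using assms open_vimage open_chart_dom[OF A] open_chart_image[OF B] by (metis open_Int)
qed

lemma smooth_on_rep:
  "c \<in> B \<Longrightarrow> d \<in> A \<Longrightarrow> smooth_on (snd c ` (fst c \<inter> f -` fst d)) (snd d \<circ> f \<circ> chart_inv c)"
  using smooth_map by (simp add: smooth_map_def)

lemma has_derivative_rep:
  assumes "c \<in> B" "d \<in> A" "x \<in> fst c" "f x \<in> fst d"
  shows "((snd d \<circ> f \<circ> chart_inv c) has_derivative chart_deriv c d f x) (at (snd c x))"
  unfolding chart_deriv_def
  by (rule smooth_on_has_derivative[OF smooth_on_rep]) (use assms in auto)

lemma linear_chart_deriv:
  "\<lbrakk>c \<in> B; d \<in> A; x \<in> fst c; f x \<in> fst d\<rbrakk> \<Longrightarrow> linear (chart_deriv c d f x)"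
  using has_derivative_rep has_derivative_linear by blast

lemma linear_tmap: "linear (tmap B A f x)"
  unfolding tmap_eq_chart_deriv
  by (intro linear_chart_deriv chart_at A B)

end

lemma manifold_map_id: "smooth_manifold A \<Longrightarrow> manifold_map A A id"
  by (simp add: manifold_map_def smooth_map_id)

text \<open>The intermediate chart \<open>d\<close> can be inserted only where \<open>f\<close>
  lands in its domain; this set is open, and the derivative at \<open>x\<close> sees no
  more.\<close>

lemma chart_deriv_comp:
  assumes "manifold_map B A f" "manifold_map A C h"
    and c: "c \<in> B" "x \<in> fst c" and d: "d \<in> A" "f x \<in> fst d" and e: "e \<in> C" "h (f x) \<in> fst e"
  shows "chart_deriv c e (h \<circ> f) x v = chart_deriv d e h (f x) (chart_deriv c d f x v)"
proof -
  interpret f: manifold_map B A f by fact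
  interpret h: manifold_map A C h by fact
  have x: "(snd d \<circ> f \<circ> chart_inv c) (snd c x) = snd d (f x)"
    using chart_inv_chart[OF f.B c] by simp
  have "(((snd e \<circ> h \<circ> chart_inv d) \<circ> (snd d \<circ> f \<circ> chart_inv c)) has_derivative
      chart_deriv d e h (f x) \<circ> chart_deriv c d f x) (at (snd c x))"
    by (intro diff_chain_at f.has_derivative_rep c d, unfold x, rule h.has_derivative_rep[OF d(1) e(1) d(2) e(2)])
  then have "((snd e \<circ> (h \<circ> f) \<circ> chart_inv c) has_derivative
      chart_deriv d e h (f x) \<circ> chart_deriv c d f x) (at (snd c x))"
  proof (rule has_derivative_transform_within_open)
    show "open (snd c ` (UNIV \<inter> fst c \<inter> f -` fst d))" using f.open_dom c d by blast
    show "snd c x \<in> snd c ` (UNIV \<inter> fst c \<inter> f -` fst d)" using c d by blast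
    show "((snd e \<circ> h \<circ> chart_inv d) \<circ> (snd d \<circ> f \<circ> chart_inv c)) z = (snd e \<circ> (h \<circ> f) \<circ> chart_inv c) z"
      if "z \<in> snd c ` (UNIV \<inter> fst c \<inter> f -` fst d)" for z
      using that chart_inv_chart[OF f.B c(1)] chart_inv_chart[OF f.A d(1)] by auto
  qed
  from frechet_derivative_at[OF this] show ?thesis by (metis chart_deriv_def comp_apply)
qed

section \<open>Coordinate fields of a chart\<close>

context
  fixes A :: "('m::{t2_space,second_countable_topology}, 'e::euclidean_space) chart set"
  assumes A: "smooth_manifold A"
begin

interpretation manifold_map A A id by (rule manifold_map_id[OF A])

lemma linear_tcoord: "c \<in> A \<Longrightarrow> x \<in> fst c \<Longrightarrow> linear (tcoord A c x)"
  unfolding tcoord_eq_chart_deriv by (intro linear_chart_deriv chart_at A) simp_all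

lemma chart_deriv_id:
  assumes "c \<in> A" "x \<in> fst c"
  shows "chart_deriv c c id x v = v"
proof -
  have "((snd c \<circ> id \<circ> chart_inv c) has_derivative (\<lambda>v. v)) (at (snd c x))"
  proof (rule has_derivative_transform_within_open[OF has_derivative_ident])
    show "open (snd c ` (UNIV \<inter> fst c))" by (rule open_chart_image[OF A assms(1) open_UNIV])
  qed (use assms chart_inv_chart[OF A assms(1)] in auto)
  from frechet_derivative_at[OF this] show ?thesis by (metis chart_deriv_def)
qed

text \<open>The vector field with constant components \<open>v\<close> in the chart
  \<open>d\<close>, rewritten at each \<open>p\<close> in the chart chosen there. For basis vectors
  \<open>v\<close> these are the usual coordinate fields.\<close>

definition coord_field :: "('m, 'e) chart \<Rightarrow> 'e \<Rightarrow> 'm \<Rightarrow> 'e" where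
  "coord_field d v p = chart_deriv d (chart_at A p) id p v"

lemma tcoord_coord_field:
  assumes "d \<in> A" "p \<in> fst d" "d' \<in> A" "p \<in> fst d'"
  shows "tcoord A d' p (coord_field d v p) = chart_deriv d d' id p v"
  using chart_deriv_comp[OF manifold_map_id[OF A] manifold_map_id[OF A],
      of d p "chart_at A p" d' v] assms
  by (simp add: tcoord_eq_chart_deriv coord_field_def chart_at[OF A])

lemma coord_field_tcoord:
  assumes "d \<in> A" "p \<in> fst d"
  shows "coord_field d (tcoord A d p v) p = v"
  using chart_deriv_comp[OF manifold_map_id[OF A] manifold_map_id[OF A],
      of "chart_at A p" p d "chart_at A p" v] assms
  by (simp add: tcoord_eq_chart_deriv coord_field_def chart_deriv_id chart_at[OF A])

lemma coord_field_chart_at: "coord_field (chart_at A p) v p = v"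
  by (simp add: coord_field_def chart_deriv_id chart_at[OF A])

lemma coord_field_expansion:
  assumes "d \<in> A" "p \<in> fst d"
  shows "v = (\<Sum>k\<in>Basis. (tcoord A d p v \<bullet> k) *\<^sub>R coord_field d k p)"
proof -
  have "linear (\<lambda>v. coord_field d v p)"
    unfolding coord_field_def using assms
    by (intro linear_chart_deriv) (simp_all add: chart_at[OF A])
  from linear_basis_expansion[OF this, of "tcoord A d p v"] show ?thesis
    by (simp add: coord_field_tcoord[OF assms])
qed

text \<open>In another chart \<open>d'\<close> the components are a directional derivative of the
  transition map from \<open>d\<close> to \<open>d'\<close>.\<close>

lemma vector_field_coord_field:
  assumes d: "d \<in> A"
  shows "vector_field A (fst d) (coord_field d v)"
  unfolding vector_field_def smooth_section_along_iff
proof (intro ballI)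
  fix c d' assume c: "c \<in> A" and d': "d' \<in> A"
  let ?S = "snd c ` (fst d \<inter> fst c \<inter> id -` fst d')" and ?T = "snd d ` (fst d \<inter> id -` fst d')"
  have S: "open ?S" using open_dom[OF open_chart_dom[OF A d] c d'] .
  have T: "open ?T" using open_dom[OF open_UNIV d d'] by simp
  let ?G = "\<lambda>z. frechet_derivative (snd d' \<circ> id \<circ> chart_inv d) (at z) v"
  have "smooth_on ?S (\<lambda>z. ?G ((snd d \<circ> id \<circ> chart_inv c) z))"
  proof (rule smooth_on_compose[OF S T, where f = "snd d \<circ> id \<circ> chart_inv c" and g = ?G])
    show "(snd d \<circ> id \<circ> chart_inv c) ` ?S \<subseteq> ?T"
      using chart_inv_chart[OF A c] by auto
    show "smooth_on ?S (snd d \<circ> id \<circ> chart_inv c)"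
      by (rule smooth_on_subset[OF smooth_on_rep[OF c d]]) auto
    show "smooth_on ?T ?G"
      by (rule smooth_on_frechet_derivative[OF smooth_on_rep[OF d d']])
  qed
  then show "smooth_on ?S (\<lambda>z. tcoord A d' (id (chart_inv c z)) (coord_field d v (chart_inv c z)))"
    by (rule smooth_on_cong[OF S, rotated])
      (use chart_inv_chart[OF A c] d d' in \<open>auto simp: tcoord_coord_field chart_deriv_def\<close>)
qed

end

section \<open>Operations on smooth sections along a map\<close>

context manifold_map
begin

lemma section_add:
  assumes V: "open V" and X: "smooth_section_along B A f V X" and Y: "smooth_section_along B A f V Y"
  shows "smooth_section_along B A f V (\<lambda>x. X x + Y x)"
  unfolding smooth_section_along_iff
proof (intro ballI)
  fix c d assume c: "c \<in> B" and d: "d \<in> A"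
  let ?S = "snd c ` (V \<inter> fst c \<inter> f -` fst d)"
  have "smooth_on ?S (\<lambda>z. tcoord A d (f (chart_inv c z)) (X (chart_inv c z)) +
      tcoord A d (f (chart_inv c z)) (Y (chart_inv c z)))"
    using X Y c d by (intro smooth_on_add open_dom V) (auto simp: smooth_section_along_iff)
  then show "smooth_on ?S (\<lambda>z. tcoord A d (f (chart_inv c z)) (X (chart_inv c z) + Y (chart_inv c z)))"
    by (rule smooth_on_cong[OF open_dom[OF V c d], rotated])
      (use d in \<open>auto simp: chart_inv_chart[OF B c] linear_add[OF linear_tcoord[OF A]]\<close>)
qed

lemma section_scale:
  assumes V: "open V" and h: "smooth_fun B V h" and X: "smooth_section_along B A f V X"
  shows "smooth_section_along B A f V (\<lambda>x. h x *\<^sub>R X x)"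
  unfolding smooth_section_along_iff
proof (intro ballI)
  fix c d assume c: "c \<in> B" and d: "d \<in> A"
  let ?S = "snd c ` (V \<inter> fst c \<inter> f -` fst d)"
  have "smooth_on (snd c ` (V \<inter> fst c)) (\<lambda>z. h (chart_inv c z))" using h c by (simp add: smooth_fun_iff)
  then have "smooth_on ?S (\<lambda>z. h (chart_inv c z))" by (rule smooth_on_subset) auto
  then have "smooth_on ?S (\<lambda>z. h (chart_inv c z) *\<^sub>R
      tcoord A d (f (chart_inv c z)) (X (chart_inv c z)))"
    using X c d by (intro smooth_on_scaleR open_dom V) (auto simp: smooth_section_along_iff)
  then show "smooth_on ?S (\<lambda>z. tcoord A d (f (chart_inv c z)) (h (chart_inv c z) *\<^sub>R X (chart_inv c z)))"
    by (rule smooth_on_cong[OF open_dom[OF V c d], rotated])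
      (use d in \<open>auto simp: chart_inv_chart[OF B c] linear_scale[OF linear_tcoord[OF A]]\<close>)
qed

lemma section_pullback:
  assumes V: "open V" "V \<subseteq> f -` U" and U: "open U" and Y: "vector_field A U Y"
  shows "smooth_section_along B A f V (\<lambda>x. Y (f x))"
  unfolding smooth_section_along_iff
proof (intro ballI)
  fix c d assume c: "c \<in> B" and d: "d \<in> A"
  let ?S = "snd c ` (V \<inter> fst c \<inter> f -` fst d)" and ?T = "snd d ` (U \<inter> fst d)"
  let ?Y = "\<lambda>z. tcoord A d (chart_inv d z) (Y (chart_inv d z))"
  have "smooth_on ?S (\<lambda>z. ?Y ((snd d \<circ> f \<circ> chart_inv c) z))"
  proof (rule smooth_on_compose[OF open_dom[OF V(1) c d] open_chart_image[OF A d U],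
        where f = "snd d \<circ> f \<circ> chart_inv c"])
    show "(snd d \<circ> f \<circ> chart_inv c) ` ?S \<subseteq> ?T"
      using V chart_inv_chart[OF B c] by auto
    show "smooth_on ?S (snd d \<circ> f \<circ> chart_inv c)"
      by (rule smooth_on_subset[OF smooth_on_rep[OF c d]]) auto
    show "smooth_on ?T ?Y"
      using Y d unfolding vector_field_iff by (metis Int_absorb inf_assoc)
  qed
  then show "smooth_on ?S (\<lambda>z. tcoord A d (f (chart_inv c z)) (Y (f (chart_inv c z))))"
    by (rule smooth_on_cong[OF open_dom[OF V(1) c d], rotated])
      (auto simp: chart_inv_chart[OF B c] chart_inv_chart[OF A d])
qed

lemma smooth_fun_pullback:
  assumes V: "open V" "V \<subseteq> f -` U" and U: "open U" and h: "smooth_fun A U h"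
    and c: "c \<in> B" and d: "d \<in> A"
  shows "smooth_on (snd c ` (V \<inter> fst c \<inter> f -` fst d)) (\<lambda>z. h (f (chart_inv c z)))"
proof -
  let ?S = "snd c ` (V \<inter> fst c \<inter> f -` fst d)" and ?T = "snd d ` (U \<inter> fst d)"
  have "smooth_on ?S (\<lambda>z. (\<lambda>z. h (chart_inv d z)) ((snd d \<circ> f \<circ> chart_inv c) z))"
  proof (rule smooth_on_compose[OF open_dom[OF V(1) c d] open_chart_image[OF A d U],
        where f = "snd d \<circ> f \<circ> chart_inv c"])
    show "(snd d \<circ> f \<circ> chart_inv c) ` ?S \<subseteq> ?T"
      using V chart_inv_chart[OF B c] by auto
    show "smooth_on ?S (snd d \<circ> f \<circ> chart_inv c)"
      by (rule smooth_on_subset[OF smooth_on_rep[OF c d]]) auto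
  qed (use h d in \<open>simp add: smooth_fun_iff\<close>)
  then show ?thesis
    by (rule smooth_on_cong[OF open_dom[OF V(1) c d], rotated])
      (auto simp: chart_inv_chart[OF B c] chart_inv_chart[OF A d])
qed

text \<open>\<open>S\<close> can be tested only on vector fields of M. Linearity over the coordinate
  expansion of \<open>X x\<close> reduces the claim to \<open>S\<close> applied to coordinate
  fields, pulled back along \<open>f\<close>.\<close>

lemma section_endo:
  assumes V: "open V" "V \<subseteq> f -` U" and U: "open U" and S: "smooth_endo A U S"
    and X: "smooth_section_along B A f V X"
  shows "smooth_section_along B A f V (\<lambda>x. blinfun_apply (S (f x)) (X x))"
  unfolding smooth_section_along_iff
proof (intro ballI)
  fix c d assume c: "c \<in> B" and d: "d \<in> A"
  let ?S = "snd c ` (V \<inter> fst c \<inter> f -` fst d)"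
  let ?E = "\<lambda>k p. blinfun_apply (S p) (coord_field A d k p)"
  have "vector_field A (U \<inter> fst d) (?E k)" for k
  proof -
    have "vector_field A (U \<inter> fst d) (coord_field A d k)"
      by (rule vector_field_restrict[OF vector_field_coord_field[OF A d]]) blast
    then show ?thesis using S U open_chart_dom[OF A d]
      unfolding smooth_endo_def by (metis inf_le1 open_Int)
  qed
  then have "smooth_section_along B A f (V \<inter> f -` fst d) (\<lambda>x. ?E k (f x))" for k
    using V U open_chart_dom[OF A d] by (intro section_pullback[of _ "U \<inter> fst d"]) (auto intro: open_vimage)
  then have E: "smooth_on ?S (\<lambda>z. tcoord A d (f (chart_inv c z)) (?E k (f (chart_inv c z))))" for k
    using c d unfolding smooth_section_along_iff by (rule_tac smooth_on_subset) (blast, blast)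
  have X: "smooth_on ?S (\<lambda>z. tcoord A d (f (chart_inv c z)) (X (chart_inv c z)))"
    using X c d by (simp add: smooth_section_along_iff)
  have "smooth_on ?S (\<lambda>z. \<Sum>k\<in>Basis. (tcoord A d (f (chart_inv c z)) (X (chart_inv c z)) \<bullet> k) *\<^sub>R
      tcoord A d (f (chart_inv c z)) (?E k (f (chart_inv c z))))"
    by (intro smooth_on_sum smooth_on_scaleR smooth_on_inner_left E X open_dom V c d)
  then show "smooth_on ?S (\<lambda>z. tcoord A d (f (chart_inv c z)) (blinfun_apply (S (f (chart_inv c z))) (X (chart_inv c z))))"
  proof (rule smooth_on_cong[OF open_dom[OF V(1) c d], rotated])
    fix z assume "z \<in> ?S"
    then obtain x where x: "x \<in> fst c" "f x \<in> fst d" "z = snd c x" by blast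
    interpret T: linear "tcoord A d (f x)" using linear_tcoord[OF A d x(2)] .
    have "tcoord A d (f x) (blinfun_apply (S (f x)) (X x)) =
        (\<Sum>k\<in>Basis. (tcoord A d (f x) (X x) \<bullet> k) *\<^sub>R tcoord A d (f x) (?E k (f x)))"
      by (subst coord_field_expansion[OF A d x(2), of "X x"])
        (simp add: blinfun.sum_right blinfun.scaleR_right T.sum T.scale)
    then show "(\<Sum>k\<in>Basis. (tcoord A d (f (chart_inv c z)) (X (chart_inv c z)) \<bullet> k) *\<^sub>R
      tcoord A d (f (chart_inv c z)) (?E k (f (chart_inv c z)))) =
      (\<lambda>z. tcoord A d (f (chart_inv c z)) (blinfun_apply (S (f (chart_inv c z))) (X (chart_inv c z)))) z"
      using x by (simp add: chart_inv_chart[OF B c])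
  qed
qed

lemma smooth_fun_metric:
  assumes g: "semi_riemannian A g" and V: "open V"
    and X: "smooth_section_along B A f V X" and Y: "smooth_section_along B A f V Y"
  shows "smooth_fun B V (\<lambda>x. g (f x) (X x) (Y x))"
  unfolding smooth_fun_iff
proof
  fix c assume c: "c \<in> B"
  have "smooth_on (snd c ` (V \<inter> fst c \<inter> f -` fst d)) (\<lambda>z. g (f (chart_inv c z)) (X (chart_inv c z)) (Y (chart_inv c z)))"
    if d: "d \<in> A" for d
  proof -
    let ?S = "snd c ` (V \<inter> fst c \<inter> f -` fst d)"
    let ?g = "\<lambda>k l p. g p (coord_field A d k p) (coord_field A d l p)"
    have "smooth_fun A (fst d) (?g k l)" for k l
      using g open_chart_dom[OF A d] vector_field_coord_field[OF A d] by (simp add: semi_riemannian_def)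
    then have "smooth_on (snd c ` ((V \<inter> f -` fst d) \<inter> fst c \<inter> f -` fst d)) (\<lambda>z. ?g k l (f (chart_inv c z)))" for k l
      using V open_chart_dom[OF A d] c d by (intro smooth_fun_pullback[of _ "fst d"]) (auto intro: open_vimage)
    then have G: "smooth_on ?S (\<lambda>z. ?g k l (f (chart_inv c z)))" for k l
      by (rule smooth_on_subset) blast
    have XY: "smooth_on ?S (\<lambda>z. tcoord A d (f (chart_inv c z)) (X (chart_inv c z)))"
      "smooth_on ?S (\<lambda>z. tcoord A d (f (chart_inv c z)) (Y (chart_inv c z)))"
      using X Y c d by (simp_all add: smooth_section_along_iff)
    have "smooth_on ?S (\<lambda>z. \<Sum>k\<in>Basis. \<Sum>l\<in>Basis.
        (tcoord A d (f (chart_inv c z)) (X (chart_inv c z)) \<bullet> k) *\<^sub>R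
        (tcoord A d (f (chart_inv c z)) (Y (chart_inv c z)) \<bullet> l) *\<^sub>R ?g k l (f (chart_inv c z)))"
      by (intro smooth_on_sum smooth_on_scaleR smooth_on_inner_left G XY open_dom V c d)
    then show ?thesis
    proof (rule smooth_on_cong[OF open_dom[OF V c d], rotated])
      fix z assume "z \<in> ?S"
      then obtain x where x: "x \<in> fst c" "f x \<in> fst d" "z = snd c x" by blast
      have bil: "bilinear (g (f x))" using g by (simp add: semi_riemannian_def)
      have "g (f x) (X x) (Y x) =
          (\<Sum>k\<in>Basis. \<Sum>l\<in>Basis. (tcoord A d (f x) (X x) \<bullet> k) *\<^sub>R
            (tcoord A d (f x) (Y x) \<bullet> l) *\<^sub>R ?g k l (f x))"
        by (subst coord_field_expansion[OF A d x(2), of "X x"],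
            subst coord_field_expansion[OF A d x(2), of "Y x"])
          (simp add: bilinear_sum[OF bil] sum.cartesian_product[symmetric]
            bilinear_lmul[OF bil] bilinear_rmul[OF bil] mult_ac)
      then show "(\<Sum>k\<in>Basis. \<Sum>l\<in>Basis. (tcoord A d (f (chart_inv c z)) (X (chart_inv c z)) \<bullet> k) *\<^sub>R
          (tcoord A d (f (chart_inv c z)) (Y (chart_inv c z)) \<bullet> l) *\<^sub>R ?g k l (f (chart_inv c z))) =
          g (f (chart_inv c z)) (X (chart_inv c z)) (Y (chart_inv c z))"
        using x by (simp add: chart_inv_chart[OF B c])
    qed
  qed
  \<comment> \<open>The expansion is available only where \<open>f\<close> lands in a given chart of
    M, but a function on N is tested on a whole chart domain of N; the charts of M cover it.\<close>
  then have "smooth_on (\<Union>d\<in>A. snd c ` (V \<inter> fst c \<inter> f -` fst d)) (\<lambda>z. g (f (chart_inv c z)) (X (chart_inv c z)) (Y (chart_inv c z)))"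
    by (intro smooth_on_UN open_dom V c)
  then show "smooth_on (snd c ` (V \<inter> fst c)) (\<lambda>z. g (f (chart_inv c z)) (X (chart_inv c z)) (Y (chart_inv c z)))"
    by (rule smooth_on_subset) (use ex_chart[OF A] in blast)
qed

text \<open>Both sides are the derivative of \<open>f\<close> from the chart chosen at
  \<open>x\<close> to \<open>d\<close>, factored once through a change of charts on M and once
  through one on N.\<close>

lemma tcoord_tmap:
  assumes c: "c \<in> B" "x \<in> fst c" and d: "d \<in> A" "f x \<in> fst d"
  shows "tcoord A d (f x) (tmap B A f x v) = chart_deriv c d f x (tcoord B c x v)"
proof -
  have "tcoord A d (f x) (tmap B A f x v) = chart_deriv (chart_at B x) d (id \<circ> f) x v"
    unfolding tcoord_eq_chart_deriv tmap_eq_chart_deriv using d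
    by (subst chart_deriv_comp[OF manifold_map_axioms manifold_map_id[OF A]])
      (auto simp: chart_at[OF A] chart_at[OF B])
  also have "\<dots> = chart_deriv (chart_at B x) d (f \<circ> id) x v" by simp
  also have "\<dots> = chart_deriv c d f (id x) (chart_deriv (chart_at B x) c id x v)"
    using c d by (intro chart_deriv_comp[OF manifold_map_id[OF B] manifold_map_axioms])
      (auto simp: chart_at[OF B])
  finally show ?thesis by (simp add: tcoord_eq_chart_deriv)
qed

text \<open>In charts the image is a combination of the columns of the Jacobian of \<open>f\<close>
  with the components of \<open>X\<close> as coefficients.\<close>

lemma section_tmap:
  assumes V: "open V" and X: "vector_field B V X"
  shows "smooth_section_along B A f V (\<lambda>x. tmap B A f x (X x))"
  unfolding smooth_section_along_iff
proof (intro ballI)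
  fix c d assume c: "c \<in> B" and d: "d \<in> A"
  let ?S = "snd c ` (V \<inter> fst c \<inter> f -` fst d)"
  let ?F = "snd d \<circ> f \<circ> chart_inv c" and ?X = "\<lambda>z. tcoord B c (chart_inv c z) (X (chart_inv c z))"
  have "smooth_on (snd c ` (V \<inter> fst c \<inter> fst c)) ?X"
    using X c unfolding vector_field_iff by blast
  then have X': "smooth_on ?S ?X" by (rule smooth_on_subset) auto
  have F: "smooth_on ?S (\<lambda>z. frechet_derivative ?F (at z) k)" for k
    by (rule smooth_on_subset[OF smooth_on_frechet_derivative[OF smooth_on_rep[OF c d]]]) blast
  have "smooth_on ?S (\<lambda>z. \<Sum>k\<in>Basis. (?X z \<bullet> k) *\<^sub>R frechet_derivative ?F (at z) k)"
    by (intro smooth_on_sum smooth_on_scaleR smooth_on_inner_left X' F open_dom V c d)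
  then show "smooth_on ?S (\<lambda>z. tcoord A d (f (chart_inv c z)) (tmap B A f (chart_inv c z) (X (chart_inv c z))))"
  proof (rule smooth_on_cong[OF open_dom[OF V c d], rotated])
    fix z assume "z \<in> ?S"
    then obtain x where x: "x \<in> fst c" "f x \<in> fst d" "z = snd c x" by blast
    show "(\<Sum>k\<in>Basis. (?X z \<bullet> k) *\<^sub>R frechet_derivative ?F (at z) k) =
        (\<lambda>z. tcoord A d (f (chart_inv c z)) (tmap B A f (chart_inv c z) (X (chart_inv c z)))) z"
      using linear_basis_expansion[OF linear_chart_deriv[OF c d x(1,2)], of "tcoord B c x (X x)"] x
      by (simp add: chart_inv_chart[OF B c] tcoord_tmap[OF c x(1) d x(2)] chart_deriv_def)
  qed
qed

end


section \<open>Local orthogonal frames\<close>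

lemma semi_riemannian_symmetric_bilinear: "semi_riemannian A g \<Longrightarrow> symmetric_bilinear (g x)"
  by (simp add: semi_riemannian_def symmetric_bilinear_def)

context manifold_map
begin

lemma section_zero:
  assumes V: "open V"
  shows "smooth_section_along B A f V (\<lambda>_. 0)"
  unfolding smooth_section_along_iff
proof (intro ballI)
  fix c d assume c: "c \<in> B" and d: "d \<in> A"
  show "smooth_on (snd c ` (V \<inter> fst c \<inter> f -` fst d)) (\<lambda>z. tcoord A d (f (chart_inv c z)) 0)"
    by (rule smooth_on_cong[OF open_dom[OF V c d] _ smooth_on_const[OF open_dom[OF V c d]], of 0])
      (use d in \<open>auto simp: chart_inv_chart[OF B c] linear_0[OF linear_tcoord[OF A]]\<close>)
qed

text \<open>Replacing the projection \<open>G - (b(G, F) / b(F, F)) F\<close> by its multiple \<open>b(F, F) G - b(G, F) F\<close>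
  avoids division, so that smoothness needs no hypothesis on the zeros of \<open>b(F, F)\<close> off \<open>x\<close>.\<close>

lemma gram_schmidt_step:
  fixes m :: nat
  assumes g: "semi_riemannian A g" and V: "open V" and x: "x \<in> V"
    and F: "\<And>i. i < m \<Longrightarrow> smooth_section_along B A f V (F i)"
    and orth: "\<And>i j y. \<lbrakk>i < m; j < m; i \<noteq> j; y \<in> V\<rbrakk> \<Longrightarrow> g (f y) (F i y) (F j y) = 0"
    and nz: "\<And>i. i < m \<Longrightarrow> g (f x) (F i x) (F i x) \<noteq> 0"
    and E: "smooth_section_along B A f V E" and Ex: "\<And>i. i < m \<Longrightarrow> g (f x) (E x) (F i x) = 0"
    and W: "\<And>y. subspace (W y)" "\<And>y. y \<in> V \<Longrightarrow> E y \<in> W y"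
      "\<And>i y. i < m \<Longrightarrow> y \<in> V \<Longrightarrow> F i y \<in> W y"
  shows "\<exists>G c. smooth_section_along B A f V G \<and> (\<forall>y\<in>V. G y \<in> W y) \<and>
    (\<forall>y\<in>V. \<forall>i<m. g (f y) (G y) (F i y) = 0) \<and> c \<noteq> 0 \<and> G x = c *\<^sub>R E x"
  using F orth nz Ex W(3)
proof (induction m)
  case 0
  then show ?case using E W by (intro exI[of _ E] exI[of _ 1]) simp
next
  case (Suc m)
  interpret b: symmetric_bilinear "g (f y)" for y using semi_riemannian_symmetric_bilinear[OF g] .
  obtain G c where G: "smooth_section_along B A f V G" "\<forall>y\<in>V. G y \<in> W y"
    "\<forall>y\<in>V. \<forall>i<m. g (f y) (G y) (F i y) = 0" "c \<noteq> 0" "G x = c *\<^sub>R E x"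
  proof -
    have "\<exists>G c. smooth_section_along B A f V G \<and> (\<forall>y\<in>V. G y \<in> W y) \<and>
      (\<forall>y\<in>V. \<forall>i<m. g (f y) (G y) (F i y) = 0) \<and> c \<noteq> 0 \<and> G x = c *\<^sub>R E x"
      by (rule Suc.IH) (use Suc.prems in simp_all)
    then show ?thesis using that by blast
  qed
  \<comment> \<open>Writing the difference with a factor -1 lets \<open>section_add\<close> and
    \<open>section_scale\<close> do the work.\<close>
  let ?G = "\<lambda>y. g (f y) (F m y) (F m y) *\<^sub>R G y + (-1) *\<^sub>R (g (f y) (G y) (F m y) *\<^sub>R F m y)"
  have Fm: "smooth_section_along B A f V (F m)" using Suc.prems(1) by simp
  have "smooth_section_along B A f V ?G"
    by (intro section_add section_scale smooth_fun_metric g V G(1) Fm smooth_fun_const[OF B])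
  moreover have "\<forall>y\<in>V. ?G y \<in> W y"
    using G(2) Suc.prems(5) W(1) by (intro ballI subspace_add subspace_scale) auto
  moreover have "\<forall>y\<in>V. \<forall>i<Suc m. g (f y) (?G y) (F i y) = 0"
    using G(3) Suc.prems(2) by (auto simp: less_Suc_eq)
  moreover have "?G x = (g (f x) (F m x) (F m x) * c) *\<^sub>R E x"
    using G(5) Suc.prems(4) by simp
  moreover have "g (f x) (F m x) (F m x) * c \<noteq> 0" using Suc.prems(3) G(4) by simp
  ultimately show ?case by blast
qed

text \<open>The family is already orthogonal at \<open>x\<close>, so there the procedure merely
  rescales it and no null vector can arise at \<open>x\<close>. The triangular bound on the spans
  keeps the initial members inside any subbundle that contains the first fields.\<close>

lemma gram_schmidt:
  assumes g: "semi_riemannian A g" and V: "open V" and x: "x \<in> V"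
    and E: "\<forall>i<n. smooth_section_along B A f V (E i)"
    and orth: "symmetric_bilinear.orthogonal_family (g (f x)) n (\<lambda>i. E i x)"
  shows "\<exists>F. (\<forall>i<n. smooth_section_along B A f V (F i)) \<and>
    (\<forall>i<n. \<forall>y\<in>V. F i y \<in> span ((\<lambda>j. E j y) ` {..i})) \<and>
    (\<forall>y\<in>V. \<forall>i<n. \<forall>j<n. i \<noteq> j \<longrightarrow> g (f y) (F i y) (F j y) = 0) \<and>
    (\<forall>i<n. \<exists>c. c \<noteq> 0 \<and> F i x = c *\<^sub>R E i x)"
proof -
  interpret b: symmetric_bilinear "g (f y)" for y using semi_riemannian_symmetric_bilinear[OF g] .
  show ?thesis
    using E orth
  proof (induction n)
    case 0
    then show ?case by simp
  next
    case (Suc n)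
    have orth: "g (f x) (E i x) (E i x) \<noteq> 0" "j < Suc n \<Longrightarrow> i \<noteq> j \<Longrightarrow> g (f x) (E i x) (E j x) = 0"
      if "i < Suc n" for i j
      using Suc.prems(2) that by (auto simp: b.orthogonal_family_def)
    then have orth_n: "b.orthogonal_family x n (\<lambda>i. E i x)" by (simp add: b.orthogonal_family_def)
    have "\<forall>i<n. smooth_section_along B A f V (E i)" using Suc.prems(1) by simp
    from Suc.IH[OF this orth_n]
    obtain F where F: "\<forall>i<n. smooth_section_along B A f V (F i)"
      "\<forall>i<n. \<forall>y\<in>V. F i y \<in> span ((\<lambda>j. E j y) ` {..i})"
      "\<forall>y\<in>V. \<forall>i<n. \<forall>j<n. i \<noteq> j \<longrightarrow> g (f y) (F i y) (F j y) = 0"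
      "\<forall>i<n. \<exists>c. c \<noteq> 0 \<and> F i x = c *\<^sub>R E i x"
      by (elim exE conjE) simp
    have "\<exists>G c. smooth_section_along B A f V G \<and> (\<forall>y\<in>V. G y \<in> span ((\<lambda>j. E j y) ` {..n})) \<and>
      (\<forall>y\<in>V. \<forall>i<n. g (f y) (G y) (F i y) = 0) \<and> c \<noteq> 0 \<and> G x = c *\<^sub>R E n x"
    proof (rule gram_schmidt_step[OF g V x])
      show "g (f x) (F i x) (F i x) \<noteq> 0" if "i < n" for i
      proof -
        obtain c where "c \<noteq> 0" "F i x = c *\<^sub>R E i x" using F(4) \<open>i < n\<close> by blast
        then show ?thesis using orth(1)[of i] \<open>i < n\<close> by simp
      qed
      show "g (f x) (E n x) (F i x) = 0" if "i < n" for i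
      proof -
        obtain c where "F i x = c *\<^sub>R E i x" using F(4) \<open>i < n\<close> by blast
        then show ?thesis using orth(2)[of n i] \<open>i < n\<close> by simp
      qed
      show "F i y \<in> span ((\<lambda>j. E j y) ` {..n})" if "i < n" "y \<in> V" for i y
      proof -
        have "F i y \<in> span ((\<lambda>j. E j y) ` {..i})" using F(2) that by blast
        also have "\<dots> \<subseteq> span ((\<lambda>j. E j y) ` {..n})" using that by (intro span_mono) auto
        finally show ?thesis .
      qed
    qed (use F Suc.prems(1) in \<open>auto intro: span_base\<close>)
    then obtain G c where G: "smooth_section_along B A f V G"
      "\<forall>y\<in>V. G y \<in> span ((\<lambda>j. E j y) ` {..n})"
      "\<forall>y\<in>V. \<forall>i<n. g (f y) (G y) (F i y) = 0" "c \<noteq> 0" "G x = c *\<^sub>R E n x" by blast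
    have G': "\<forall>y\<in>V. \<forall>i<n. g (f y) (F i y) (G y) = 0" using G(3) by (simp add: b.sym[of _ "F _ _"])
    let ?F = "\<lambda>i. if i < n then F i else G"
    have "\<forall>i<Suc n. smooth_section_along B A f V (?F i)" using F(1) G(1) by simp
    moreover have "\<forall>i<Suc n. \<forall>y\<in>V. ?F i y \<in> span ((\<lambda>j. E j y) ` {..i})"
      using F(2) G(2) by (auto simp: less_Suc_eq)
    moreover have "\<forall>y\<in>V. \<forall>i<Suc n. \<forall>j<Suc n. i \<noteq> j \<longrightarrow> g (f y) (?F i y) (?F j y) = 0"
      using F(3) G(3) G' by (auto simp: less_Suc_eq)
    moreover have "\<forall>i<Suc n. \<exists>c. c \<noteq> 0 \<and> ?F i x = c *\<^sub>R E i x"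
      using F(4) G(4,5) by (auto simp: less_Suc_eq)
    ultimately show ?case by (intro exI[of _ ?F] conjI)
  qed
qed

text \<open>Orthogonality holds on all of \<open>V\<close>; only the squares may vanish away from
  \<open>x\<close>. They are continuous and nonzero at \<open>x\<close>, so a smaller neighbourhood
  excludes this.\<close>

lemma local_orthogonal_frame:
  assumes g: "semi_riemannian A g" and V: "open V" and x: "x \<in> V"
    and E: "\<forall>i<n. smooth_section_along B A f V (E i)"
    and orth: "symmetric_bilinear.orthogonal_family (g (f x)) n (\<lambda>i. E i x)"
  obtains F V' where "open V'" "x \<in> V'" "V' \<subseteq> V"
    "\<And>i. i < n \<Longrightarrow> smooth_section_along B A f V' (F i)"
    "\<And>i y. i < n \<Longrightarrow> y \<in> V' \<Longrightarrow> F i y \<in> span ((\<lambda>j. E j y) ` {..i})"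
    "\<And>y. y \<in> V' \<Longrightarrow> symmetric_bilinear.orthogonal_family (g (f y)) n (\<lambda>i. F i y)"
proof -
  interpret b: symmetric_bilinear "g (f y)" for y using semi_riemannian_symmetric_bilinear[OF g] .
  from gram_schmidt[OF assms]
  obtain F where F: "\<forall>i<n. smooth_section_along B A f V (F i)"
    "\<forall>i<n. \<forall>y\<in>V. F i y \<in> span ((\<lambda>j. E j y) ` {..i})"
    "\<forall>y\<in>V. \<forall>i<n. \<forall>j<n. i \<noteq> j \<longrightarrow> g (f y) (F i y) (F j y) = 0"
    "\<forall>i<n. \<exists>c. c \<noteq> 0 \<and> F i x = c *\<^sub>R E i x"
    by (elim exE conjE) simp
  let ?h = "\<lambda>i y. g (f y) (F i y) (F i y)"
  \<comment> \<open>The leading \<open>V\<close> takes care of \<open>n = 0\<close>, where the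
    indexed intersection is the whole manifold.\<close>
  define V' where "V' = V \<inter> (\<Inter>i\<in>{..<n}. V \<inter> ?h i -` (- {0}))"
  have "open (V \<inter> ?h i -` (- {0}))" if "i < n" for i
    using F(1) that by (intro continuous_open_preimage smooth_fun_continuous[OF B] smooth_fun_metric g V) auto
  then have "open V'" unfolding V'_def using V by (intro open_Int open_INT) auto
  moreover have "?h i x \<noteq> 0" if "i < n" for i
  proof -
    obtain c where "c \<noteq> 0" "F i x = c *\<^sub>R E i x" using F(4) \<open>i < n\<close> by blast
    moreover have "g (f x) (E i x) (E i x) \<noteq> 0"
      using orth[unfolded b.orthogonal_family_def] that by simp
    ultimately show ?thesis by simp
  qed
  then have "x \<in> V'" using x by (simp add: V'_def)
  moreover have "V' \<subseteq> V" by (auto simp: V'_def)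
  moreover have "smooth_section_along B A f V' (F i)" if "i < n" for i
    by (rule smooth_section_along_restrict[OF _ \<open>V' \<subseteq> V\<close>]) (use F(1) that in simp)
  moreover have "F i y \<in> span ((\<lambda>j. E j y) ` {..i})" if "i < n" "y \<in> V'" for i y
    using F(2) that \<open>V' \<subseteq> V\<close> by blast
  moreover have "b.orthogonal_family y n (\<lambda>i. F i y)" if "y \<in> V'" for y
    using F(3) that by (auto simp: b.orthogonal_family_def V'_def split: if_splits)
  ultimately show ?thesis by (rule that)
qed

end

section \<open>Extending a vector to a local section\<close>

context
  fixes B :: "('n::{t2_space,second_countable_topology}, 'f::euclidean_space) chart set"
  assumes B: "smooth_manifold B"
begin

interpretation manifold_map B B id by (rule manifold_map_id[OF B])

lemma extend_to_vector_field:
  "\<exists>Y. vector_field B (fst (chart_at B x)) Y \<and> Y x = v"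
  using vector_field_coord_field[OF B chart_at(1)[OF B]] coord_field_chart_at[OF B] by blast

text \<open>The values at \<open>x\<close> of sections of \<open>D\<close> over \<open>V\<close>
  form a subspace containing the frame vectors, hence all of \<open>D x\<close>. One neighbourhood
  \<open>V\<close> serves every \<open>v\<close>.\<close>

lemma extend_in_distribution:
  assumes "distribution B r D"
  obtains V where "open V" "x \<in> V"
    "\<And>v. v \<in> D x \<Longrightarrow> \<exists>Y. vector_field B V Y \<and> (\<forall>y\<in>V. Y y \<in> D y) \<and> Y x = v"
proof -
  obtain V X where V: "open V" "x \<in> V" and X: "\<forall>i<r. vector_field B V (X i)"
    and D: "\<forall>y\<in>V. span ((\<lambda>i. X i y) ` {..<r}) = D y"
    using assms unfolding distribution_def subbundle_along_def vector_field_def by meson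
  let ?K = "{Y x | Y. vector_field B V Y \<and> (\<forall>y\<in>V. Y y \<in> D y)}"
  have sub: "subspace (D y)" if "y \<in> V" for y using D that by (metis subspace_span)
  have "span ((\<lambda>i. X i x) ` {..<r}) \<subseteq> ?K"
  proof (rule span_minimal)
    show "(\<lambda>i. X i x) ` {..<r} \<subseteq> ?K"
      using X D by (fastforce intro: span_base)
    show "subspace ?K"
    proof (rule subspaceI)
      show "0 \<in> ?K"
        using section_zero[OF V(1)] subspace_0[OF sub]
        unfolding vector_field_def by (intro CollectI exI[of _ "\<lambda>_. 0"]) auto
    next
      fix u v assume "u \<in> ?K" "v \<in> ?K"
      then obtain Y Z where "vector_field B V Y" "\<forall>y\<in>V. Y y \<in> D y" "u = Y x"
        "vector_field B V Z" "\<forall>y\<in>V. Z y \<in> D y" "v = Z x" by blast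
      then show "u + v \<in> ?K"
        using section_add[OF V(1), of Y Z] subspace_add[OF sub]
        unfolding vector_field_def by (intro CollectI exI[of _ "\<lambda>y. Y y + Z y"]) auto
    next
      fix c u assume "u \<in> ?K"
      then obtain Y where "vector_field B V Y" "\<forall>y\<in>V. Y y \<in> D y" "u = Y x" by blast
      then show "c *\<^sub>R u \<in> ?K"
        using section_scale[OF V(1) smooth_fun_const[OF B V(1)], of Y c] subspace_scale[OF sub]
        unfolding vector_field_def by (intro CollectI exI[of _ "\<lambda>y. c *\<^sub>R Y y"]) auto
    qed
  qed
  then have "\<exists>Y. vector_field B V Y \<and> (\<forall>y\<in>V. Y y \<in> D y) \<and> Y x = v" if "v \<in> D x" for v
    using D V(2) that by auto
  then show ?thesis using that V by blast
qed

end


section \<open>CR-submanifolds\<close>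

locale CR_submanifold =
  fixes A :: "('m::{t2_space,second_countable_topology}, 'e::euclidean_space) chart set"
    and B :: "('n::{t2_space,second_countable_topology}, 'f::euclidean_space) chart set"
    and f :: "'n \<Rightarrow> 'm"
    and \<sigma> :: "'m \<Rightarrow> ('e \<Rightarrow>\<^sub>L 'e) set"
    and g :: "'m \<Rightarrow> 'e \<Rightarrow> 'e \<Rightarrow> real"
    and D :: "'n \<Rightarrow> 'f set"
  assumes smooth_A: "smooth_manifold A" and hermitian: "almost_paraquaternionic_hermitian A \<sigma> g"
    and CR: "paraquaternionic_CR B A f \<sigma> g D"
begin

lemma g: "semi_riemannian A g"
  using hermitian by (simp add: almost_paraquaternionic_hermitian_def)

sublocale manifold_map B A f
  using CR smooth_A
  by unfold_locales (auto simp: paraquaternionic_CR_def nondegenerate_submanifold_def immersion_def)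

sublocale g: symmetric_bilinear "g p" for p
  by (rule semi_riemannian_symmetric_bilinear[OF g])

abbreviation "T \<equiv> tmap B A f"
abbreviation "h \<equiv> induced_metric B A f g"
abbreviation "E \<equiv> Dperp B A f g D"

sublocale h: symmetric_bilinear "h x" for x
proof
  have "bilinear (g (f x))" by (rule g.bilinear)
  then show "bilinear (h x)"
    unfolding bilinear_def induced_metric_def
    using linear_compose[OF linear_tmap, unfolded o_def] by blast
qed (simp add: induced_metric_def g.sym)

lemma nondegenerate_h: "nondegenerate_on (h x) UNIV"
  using CR by (simp add: paraquaternionic_CR_def nondegenerate_submanifold_def)

lemma nondegenerate_D: "nondegenerate_on (h x) (D x)"
  using CR by (simp add: paraquaternionic_CR_def)

lemma inj_T: "inj (T x)"
  using CR by (simp add: paraquaternionic_CR_def nondegenerate_submanifold_def immersion_def)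

definition "rank_D = (SOME k. distribution B k D)"

lemma distribution_D: "distribution B rank_D D"
  unfolding rank_D_def using CR by (intro someI_ex[of "\<lambda>k. distribution B k D"]) (simp add: paraquaternionic_CR_def)

lemma subspace_D: "subspace (D x)" and dim_D: "dim (D x) = rank_D"
proof -
  obtain V X where "x \<in> V" "\<forall>y\<in>V. span ((\<lambda>i. X i y) ` {..<rank_D}) = D y \<and> dim (D y) = rank_D"
    using distribution_D unfolding distribution_def subbundle_along_def by meson
  then have "span ((\<lambda>i. X i x) ` {..<rank_D}) = D x" "dim (D x) = rank_D" by blast+
  then show "subspace (D x)" "dim (D x) = rank_D" using subspace_span by metis+
qed

lemma subspace_E: "subspace (E x)"
  unfolding Dperp_def by (rule h.subspace_orth_in[OF subspace_UNIV])

lemma nondegenerate_E: "nondegenerate_on (h x) (E x)"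
  unfolding Dperp_def by (rule h.nondegenerate_orth_in[OF subspace_D nondegenerate_D nondegenerate_h])

text \<open>This makes the dimension \<open>s\<close> of the theorem independent of the
  point.\<close>

lemma dim_E: "rank_D + dim (E x) = DIM('f)"
  using h.dim_orth_in[OF subspace_D nondegenerate_D, of x] by (simp add: Dperp_def dim_D)

lemma dim_T_image: "dim (T x ` S) = dim S"
  by (rule dim_image_eq[OF linear_tmap inj_on_subset[OF inj_T subset_UNIV]])

lemma range_T: "v \<in> range (T x) \<Longrightarrow> \<exists>w\<in>T x ` D x. v - w \<in> T x ` E x"
proof -
  assume "v \<in> range (T x)"
  then obtain u where u: "v = T x u" by blast
  obtain w where w: "w \<in> D x" "u - w \<in> E x"
    using h.ex_orthogonal_projection[OF subspace_D nondegenerate_D] unfolding Dperp_def by blast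
  have "v - T x w = T x (u - w)" by (simp add: u linear_diff[OF linear_tmap])
  then show ?thesis using w by blast
qed

text \<open>Brings the normal space into the shape \<open>N\<close> of \<open>CR_point\<close>: by
  nondegeneracy of \<open>D x\<close>, the images of \<open>D x\<close> and \<open>E x\<close>
  together span the tangent space of N.\<close>

lemma normal_fibre_eq: "normal_fibre B A f g x = orth_in (g (f x)) UNIV (T x ` D x \<union> T x ` E x)"
proof
  show "normal_fibre B A f g x \<subseteq> orth_in (g (f x)) UNIV (T x ` D x \<union> T x ` E x)"
    by (auto simp: normal_fibre_def orth_in_def)
  show "orth_in (g (f x)) UNIV (T x ` D x \<union> T x ` E x) \<subseteq> normal_fibre B A f g x"
  proof
    fix w assume w: "w \<in> orth_in (g (f x)) UNIV (T x ` D x \<union> T x ` E x)"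
    have "g (f x) w v = 0" if "v \<in> range (T x)" for v
    proof -
      obtain u where "u \<in> T x ` D x" "v - u \<in> T x ` E x" using range_T \<open>v \<in> range (T x)\<close> by blast
      then have "g (f x) w u = 0" "g (f x) w (v - u) = 0" using w unfolding orth_in_def by blast+
      then show ?thesis by simp
    qed
    then show "w \<in> normal_fibre B A f g x" by (simp add: normal_fibre_def orth_in_def)
  qed
qed

lemma CR_point:
  assumes J: "canonical_basis A \<sigma> U J" and x: "f x \<in> U"
  shows "CR_point (g (f x)) (\<lambda>\<alpha>. blinfun_apply (J \<alpha> (f x))) (T x ` D x) (T x ` E x)"
proof unfold_locales
  let ?J = "\<lambda>\<alpha>. blinfun_apply (J \<alpha> (f x))"
  have eq: "J \<alpha> (f x) o\<^sub>L J \<alpha> (f x) = - (eps \<alpha> *\<^sub>R id_blinfun)"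
    "J \<alpha> (f x) o\<^sub>L J (\<alpha> + 1) (f x) = - (J (\<alpha> + 1) (f x) o\<^sub>L J \<alpha> (f x))"
    "J \<alpha> (f x) o\<^sub>L J (\<alpha> + 1) (f x) = eps (\<alpha> + 2) *\<^sub>R J (\<alpha> + 2) (f x)" for \<alpha>
    using J x unfolding canonical_basis_def by blast+
  show "?J \<alpha> (u + v) = ?J \<alpha> u + ?J \<alpha> v" "?J \<alpha> (c *\<^sub>R u) = c *\<^sub>R ?J \<alpha> u" for \<alpha> c u v
    by (rule blinfun.add_right blinfun.scaleR_right)+
  show "?J \<alpha> (?J \<alpha> v) = - eps \<alpha> *\<^sub>R v" for \<alpha> v
    using arg_cong[OF eq(1), of "\<lambda>S. blinfun_apply S v"]
    by (simp add: blinfun.minus_left blinfun.scaleR_left)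
  show succ: "?J \<alpha> (?J (\<alpha> + 1) v) = eps (\<alpha> + 2) *\<^sub>R ?J (\<alpha> + 2) v" for \<alpha> v
    using arg_cong[OF eq(3), of "\<lambda>S. blinfun_apply S v"] by (simp add: blinfun.scaleR_left)
  show "?J (\<alpha> + 1) (?J \<alpha> v) = - eps (\<alpha> + 2) *\<^sub>R ?J (\<alpha> + 2) v" for \<alpha> v
    using arg_cong[OF eq(2), of "\<lambda>S. blinfun_apply S v" \<alpha>] succ[of \<alpha> v]
    by (simp add: blinfun.minus_left)
  show "g (f x) (?J \<alpha> u) (?J \<alpha> v) = eps \<alpha> * g (f x) u v" for \<alpha> u v
    using hermitian J x unfolding almost_paraquaternionic_hermitian_def by blast
  show "subspace (T x ` E x)" by (rule linear_subspace_image[OF linear_tmap subspace_E])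
  have CRJ: "?J \<alpha> ` T x ` D x = T x ` D x" "?J \<alpha> ` T x ` E x \<subseteq> normal_fibre B A f g x" for \<alpha>
    using CR J x unfolding paraquaternionic_CR_def by blast+
  show "?J \<alpha> ` T x ` D x = T x ` D x" for \<alpha> by (rule CRJ)
  show "g (f x) (?J \<alpha> u) w = 0" if "u \<in> T x ` E x" "w \<in> T x ` D x" for \<alpha> u w
    using CRJ(2)[of \<alpha>] that unfolding normal_fibre_eq by (auto simp: orth_in_def)
  show "g (f x) (?J \<alpha> u) w = 0" if "u \<in> T x ` E x" "w \<in> T x ` E x" for \<alpha> u w
    using CRJ(2)[of \<alpha>] that unfolding normal_fibre_eq by (auto simp: orth_in_def)
  show "nondegenerate_on (g (f x)) (T x ` E x)"
    using nondegenerate_E[of x] linear_0[OF linear_tmap]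
    by (auto simp: nondegenerate_on_def induced_metric_def)
qed

lemma ex_canonical_basis: "\<exists>U J. canonical_basis A \<sigma> U J \<and> f x \<in> U"
proof -
  have "\<exists>U J. f x \<in> U \<and> (\<exists>c\<in>A. U \<subseteq> fst c) \<and> canonical_basis A \<sigma> U J"
    using hermitian unfolding almost_paraquaternionic_hermitian_def almost_paraquaternionic_def
    by (elim conjE) (erule spec)
  then show ?thesis by blast
qed

text \<open>Evaluation at a fixed vector is linear in the endomorphism, so an element of \<sigma>
  sends \<open>v\<close> to a combination of the vectors \<open>J \<alpha> p v\<close>.\<close>

lemma span_J_eq:
  assumes J: "canonical_basis A \<sigma> U J" and p: "p \<in> U"
  shows "span (\<Union>\<alpha>. blinfun_apply (J \<alpha> p) ` P) = span (\<Union>S\<in>\<sigma> p. blinfun_apply S ` P)"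
proof
  have \<sigma>: "\<sigma> p = span (range (\<lambda>\<alpha>. J \<alpha> p))" using J p unfolding canonical_basis_def by blast
  show "span (\<Union>\<alpha>. blinfun_apply (J \<alpha> p) ` P) \<subseteq> span (\<Union>S\<in>\<sigma> p. blinfun_apply S ` P)"
    unfolding \<sigma> by (intro span_mono) (auto intro: span_base)
  let ?Q = "span (\<Union>\<alpha>. blinfun_apply (J \<alpha> p) ` P)"
  have "blinfun_apply S v \<in> ?Q" if S: "S \<in> \<sigma> p" and v: "v \<in> P" for S v
  proof -
    have "subspace {S. blinfun_apply S v \<in> ?Q}"
      by (auto intro!: subspaceI simp: blinfun.add_left blinfun.scaleR_left span_add span_scale span_zero)
    moreover have "range (\<lambda>\<alpha>. J \<alpha> p) \<subseteq> {S. blinfun_apply S v \<in> ?Q}"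
      using v by (auto intro: span_base)
    ultimately have "\<sigma> p \<subseteq> {S. blinfun_apply S v \<in> ?Q}" unfolding \<sigma> by (intro span_minimal)
    then show ?thesis using S by blast
  qed
  then show "span (\<Union>S\<in>\<sigma> p. blinfun_apply S ` P) \<subseteq> ?Q"
    by (intro span_minimal subspace_span) auto
qed

lemma direct_sum_of_nu_sub_iff:
  assumes J: "canonical_basis A \<sigma> U J" and x: "f x \<in> U"
  shows "direct_sum_of W (\<lambda>\<alpha>. nu_sub B A f g D J \<alpha> x) \<longleftrightarrow>
    W = span (\<Union>S\<in>\<sigma> (f x). blinfun_apply S ` T x ` E x)"
proof -
  interpret p: CR_point "g (f x)" "\<lambda>\<alpha>. blinfun_apply (J \<alpha> (f x))" "T x ` D x" "T x ` E x"
    by (rule CR_point[OF J x])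
  show ?thesis
    unfolding nu_sub_def span_J_eq[OF J x, symmetric]
    using p.direct_sum direct_sum_of_span[OF _ p.subspace_J_P, of W "\<lambda>\<alpha>. \<alpha>"] by metis
qed

text \<open>Only \<open>\<sigma>\<close> enters on the right-hand side, so the choice of the canonical basis is irrelevant.\<close>

lemma nu_perp_eq_span: "nu_perp B A f \<sigma> g D x = span (\<Union>S\<in>\<sigma> (f x). blinfun_apply S ` T x ` E x)"
proof -
  let ?S = "\<lambda>W. \<exists>U J. canonical_basis A \<sigma> U J \<and> f x \<in> U \<and>
     direct_sum_of W (\<lambda>\<alpha>. nu_sub B A f g D J \<alpha> x)"
  obtain U J where J: "canonical_basis A \<sigma> U J" "f x \<in> U" using ex_canonical_basis by blast
  have "?S (span (\<Union>S\<in>\<sigma> (f x). blinfun_apply S ` T x ` E x))"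
    using J direct_sum_of_nu_sub_iff[OF J] by (intro exI[of _ U] exI[of _ J]) simp
  then have "?S (nu_perp B A f \<sigma> g D x)" unfolding nu_perp_def by (rule someI)
  then show ?thesis by (elim exE conjE) (simp only: direct_sum_of_nu_sub_iff)
qed

lemma nu_perp_eq:
  assumes "canonical_basis A \<sigma> U J" "f x \<in> U"
  shows "nu_perp B A f \<sigma> g D x = span (\<Union>\<alpha>. blinfun_apply (J \<alpha> (f x)) ` T x ` E x)"
  by (simp add: nu_perp_eq_span span_J_eq[OF assms])

text \<open>A single orthogonalisation over the whole of \<open>TN\<close> suffices: it starts with a frame of
  \<open>\<D>\<close>, so every later member of the frame is automatically in \<open>\<D>\<^sup>\<bottom>\<close>, not only at the given point.\<close>

lemma local_frame_E:
  fixes x :: 'n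
  obtains V F where "open V" "x \<in> V"
    "\<And>j. j < DIM('f) - rank_D \<Longrightarrow> smooth_section_along B A f V (F j)"
    "\<And>y. y \<in> V \<Longrightarrow> g.orthogonal_family (f y) (DIM('f) - rank_D) (\<lambda>j. F j y)"
    "\<And>y j. y \<in> V \<Longrightarrow> j < DIM('f) - rank_D \<Longrightarrow> F j y \<in> T y ` E y"
proof -
  let ?s = "DIM('f) - rank_D"
  have s: "dim (E y) = ?s" for y using dim_E[of y] by simp
  obtain d where d: "h.orthogonal_family x rank_D d" "\<forall>i<rank_D. d i \<in> D x"
    using h.ex_orthogonal_family[OF subspace_D nondegenerate_D, of x] by (auto simp: dim_D)
  obtain e where e: "h.orthogonal_family x ?s e" "\<forall>i<?s. e i \<in> E x"
    using h.ex_orthogonal_family[OF subspace_E nondegenerate_E, of x] by (auto simp: s)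
  obtain V1 where V1: "open V1" "x \<in> V1"
    "\<And>v. v \<in> D x \<Longrightarrow> \<exists>Y. vector_field B V1 Y \<and> (\<forall>y\<in>V1. Y y \<in> D y) \<and> Y x = v"
    using extend_in_distribution[OF B distribution_D] by blast
  let ?V = "V1 \<inter> fst (chart_at B x)"
  have V: "open ?V" "x \<in> ?V"
    using V1 open_chart_dom[OF B chart_at(1)[OF B]] chart_at(2)[OF B] by auto
  let ?d = "\<lambda>i. if i < rank_D then d i else e (i - rank_D)"
  \<comment> \<open>Only the first \<open>rank_D\<close> fields have to stay in \<open>D\<close>
    away from \<open>x\<close>; the others are arbitrary extensions, which the orthogonalisation
    corrects.\<close>
  have "\<exists>Y. vector_field B ?V Y \<and> (i < rank_D \<longrightarrow> (\<forall>y\<in>?V. Y y \<in> D y)) \<and> Y x = ?d i" for i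
  proof (cases "i < rank_D")
    case True
    then show ?thesis using V1(3)[of "d i"] d(2) vector_field_restrict[of B V1 _ ?V] by auto
  next
    case False
    then show ?thesis
      using extend_to_vector_field[OF B, of x "e (i - rank_D)"]
        vector_field_restrict[of B "fst (chart_at B x)" _ ?V] by auto
  qed
  then obtain Y where Y: "\<And>i. vector_field B ?V (Y i)" "\<And>i y. i < rank_D \<Longrightarrow> y \<in> ?V \<Longrightarrow> Y i y \<in> D y"
    "\<And>i. Y i x = ?d i" by metis
  have de: "h x (d i) (e j) = 0" "h x (e j) (d i) = 0" if "i < rank_D" "j < ?s" for i j
    using d(2) e(2) that by (auto simp: Dperp_def orth_in_def h.sym[of _ "d i"])
  have "h.orthogonal_family x (rank_D + ?s) ?d"
    using d(1) e(1) de by (auto simp: h.orthogonal_family_def)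
  then have orth: "g.orthogonal_family (f x) (rank_D + ?s) (\<lambda>i. T x (Y i x))"
    by (simp add: h.orthogonal_family_def g.orthogonal_family_def Y(3) induced_metric_def)
  have TY: "\<forall>i<rank_D + ?s. smooth_section_along B A f ?V (\<lambda>y. T y (Y i y))"
    using section_tmap[OF V(1) Y(1)] by blast
  obtain F V' where V': "open V'" "x \<in> V'" "V' \<subseteq> ?V"
    and F: "\<And>i. i < rank_D + ?s \<Longrightarrow> smooth_section_along B A f V' (F i)"
      "\<And>i y. i < rank_D + ?s \<Longrightarrow> y \<in> V' \<Longrightarrow> F i y \<in> span ((\<lambda>j. T y (Y j y)) ` {..i})"
      "\<And>y. y \<in> V' \<Longrightarrow> g.orthogonal_family (f y) (rank_D + ?s) (\<lambda>i. F i y)"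
    by (rule local_orthogonal_frame[OF g V TY orth]) blast
  have "F (rank_D + j) y \<in> T y ` E y" if y: "y \<in> V'" and j: "j < ?s" for y j
  proof -
    have sub: "subspace (T y ` D y)" by (rule linear_subspace_image[OF linear_tmap subspace_D])
    have FD: "F i y \<in> T y ` D y" if "i < rank_D" for i
    proof -
      have "Y j y \<in> D y" if "j \<le> i" for j
        using Y(2)[of j y] y V'(3) \<open>i < rank_D\<close> that by auto
      then have "span ((\<lambda>j. T y (Y j y)) ` {..i}) \<subseteq> T y ` D y"
        by (intro span_minimal sub) auto
      then show ?thesis using F(2)[of i y] y \<open>i < rank_D\<close> by auto
    qed
    have orth: "g.orthogonal_family (f y) (rank_D + ?s) (\<lambda>i. F i y)" using F(3) y .
    \<comment> \<open>The orthogonal vectors in the image of \<open>D y\<close> are as many as its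
      dimension, so they exhaust it.\<close>
    have span: "span ((\<lambda>i. F i y) ` {..<rank_D}) = T y ` D y"
      using orth FD by (intro g.orthogonal_family_span[of "f y"] sub)
        (auto simp: g.orthogonal_family_def dim_T_image dim_D)
    have perp_F: "g (f y) (F (rank_D + j) y) (F i y) = 0" if "i < rank_D" for i
      using orth that j by (simp add: g.orthogonal_family_def)
    have perp: "g (f y) (F (rank_D + j) y) w = 0" if "w \<in> T y ` D y" for w
      by (rule g.orth_to_span[of "(\<lambda>i. F i y) ` {..<rank_D}"]) (use perp_F span that in auto)
    \<comment> \<open>The later members remain tangent to N and thus have a preimage
      \<open>u\<close>; since the metric on N is induced, orthogonality to the image of
      \<open>D y\<close> puts \<open>u\<close> in \<open>E y\<close>.\<close>
    have "span ((\<lambda>j. T y (Y j y)) ` {..rank_D + j}) \<subseteq> range (T y)"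
      by (intro span_minimal linear_subspace_image linear_tmap subspace_UNIV) auto
    moreover have "F (rank_D + j) y \<in> span ((\<lambda>j. T y (Y j y)) ` {..rank_D + j})"
      by (rule F(2)[OF _ y]) (use j in linarith)
    ultimately obtain u where u: "F (rank_D + j) y = T y u" by blast
    then have "u \<in> E y" using perp by (simp add: Dperp_def orth_in_def induced_metric_def)
    then show ?thesis using u by blast
  qed
  moreover have "g.orthogonal_family (f y) ?s (\<lambda>j. F (rank_D + j) y)" if "y \<in> V'" for y
    using F(3)[OF that] by (auto simp: g.orthogonal_family_def)
  ultimately show ?thesis
    using V' F(1) by (intro that[of V' "\<lambda>j. F (rank_D + j)"]) auto
qed

text \<open>One canonical basis around \<open>f x\<close> serves all nearby points, whatever basis
  \<open>nu_perp\<close> picked there; \<open>nu_perp_eq\<close> reconciles the two.\<close>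

lemma subbundle_nu_perp: "subbundle_along B A f (3 * (DIM('f) - rank_D)) (nu_perp B A f \<sigma> g D)"
  unfolding subbundle_along_def
proof
  fix x
  let ?s = "DIM('f) - rank_D"
  obtain V F where V: "open V" "x \<in> V"
    and F: "\<And>j. j < ?s \<Longrightarrow> smooth_section_along B A f V (F j)"
      "\<And>y. y \<in> V \<Longrightarrow> g.orthogonal_family (f y) ?s (\<lambda>j. F j y)"
      "\<And>y j. y \<in> V \<Longrightarrow> j < ?s \<Longrightarrow> F j y \<in> T y ` E y"
    by (rule local_frame_E[of x]) blast
  obtain U J where J: "canonical_basis A \<sigma> U J" and x: "f x \<in> U"
    using ex_canonical_basis by blast
  have U: "open U" "\<And>\<alpha>. smooth_endo A U (J \<alpha>)" using J by (simp_all add: canonical_basis_def)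
  let ?V = "V \<inter> f -` U"
  let ?X = "\<lambda>i y. blinfun_apply (J (of_nat (i mod 3)) (f y)) (F (i div 3) y)"
  have V': "open ?V" using V(1) open_vimage[OF U(1)] by blast
  have "smooth_section_along B A f ?V (?X i)" if "i < 3 * ?s" for i
  proof (rule section_endo[OF V' _ U(1) U(2)])
    show "smooth_section_along B A f ?V (F (i div 3))"
    proof (rule smooth_section_along_restrict[of B A f V])
      show "smooth_section_along B A f V (F (i div 3))" by (rule F(1)) (use that in linarith)
    qed blast
  qed blast
  moreover have "span ((\<lambda>i. ?X i y) ` {..<3 * ?s}) = nu_perp B A f \<sigma> g D y \<and>
      dim (nu_perp B A f \<sigma> g D y) = 3 * ?s" if "y \<in> ?V" for y
  proof -
    have y: "y \<in> V" "f y \<in> U" using that by auto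
    interpret p: CR_point "g (f y)" "\<lambda>\<alpha>. blinfun_apply (J \<alpha> (f y))" "T y ` D y" "T y ` E y"
      by (rule CR_point[OF J y(2)])
    have dim: "dim p.Q = 3 * ?s" unfolding p.dim_Q dim_T_image using dim_E[of y] by simp
    have "span ((\<lambda>i. ?X i y) ` {..<3 * ?s}) = p.Q"
    proof (rule g.orthogonal_family_span[OF _ subspace_span dim])
      show "g.orthogonal_family (f y) (3 * ?s) (\<lambda>i. ?X i y)"
        by (rule p.orthogonal_family_J[OF F(2)[OF y(1)] F(3)[OF y(1)]])
      show "?X i y \<in> p.Q" if "i < 3 * ?s" for i
      proof (intro span_base UN_I[of "of_nat (i mod 3)"] imageI)
        show "F (i div 3) y \<in> T y ` E y" by (rule F(3)[OF y(1)]) (use that in linarith)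
      qed simp
    qed
    then show ?thesis using dim by (simp only: nu_perp_eq[OF J y(2)])
  qed
  ultimately show "\<exists>V X. open V \<and> x \<in> V \<and> (\<forall>i<3 * ?s. smooth_section_along B A f V (X i)) \<and>
      (\<forall>y\<in>V. span ((\<lambda>i. X i y) ` {..<3 * ?s}) = nu_perp B A f \<sigma> g D y \<and>
        dim (nu_perp B A f \<sigma> g D y) = 3 * ?s)"
    using V V' x by (intro exI[of _ ?V] exI[of _ ?X]) auto
qed

end

theorem proposition3p9:
  fixes A :: "('m::{t2_space,second_countable_topology}, 'e::euclidean_space) chart set"
    and B :: "('n::{t2_space,second_countable_topology}, 'f::euclidean_space) chart set"
    and f :: "'n \<Rightarrow> 'm"
    and \<sigma> :: "'m \<Rightarrow> ('e \<Rightarrow>\<^sub>L 'e) set"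
    and g :: "'m \<Rightarrow> 'e \<Rightarrow> 'e \<Rightarrow> real"
    and D :: "'n \<Rightarrow> 'f set"
    and U :: "'m set"
    and J :: "3 \<Rightarrow> 'm \<Rightarrow> 'e \<Rightarrow>\<^sub>L 'e"
  assumes "paraquaternionic_kaehler A \<sigma> g"
    and "paraquaternionic_CR B A f \<sigma> g D"
    and "canonical_basis A \<sigma> U J"
  shows
    "(\<forall>x. f x \<in> U \<longrightarrow>
        direct_sum_of (nu_perp B A f \<sigma> g D x) (\<lambda>\<alpha>. nu_sub B A f g D J \<alpha> x)) \<and>
     (\<forall>x \<alpha>. f x \<in> U \<longrightarrow>
        blinfun_apply (J \<alpha> (f x)) ` nu_sub B A f g D J \<alpha> x = tmap B A f x ` Dperp B A f g D x) \<and>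
     (\<forall>x p. f x \<in> U \<and> p permutes (UNIV :: 3 set) \<and> evenperm p \<longrightarrow>
        blinfun_apply (J (p 1) (f x)) ` nu_sub B A f g D J (p 2) x = nu_sub B A f g D J (p 3) x) \<and>
     (\<exists>s. (\<forall>x. dim (Dperp B A f g D x) = s) \<and>
        subbundle_along B A f (3 * s) (nu_perp B A f \<sigma> g D) \<and>
        (\<forall>x. nu_perp B A f \<sigma> g D x \<subseteq> normal_fibre B A f g x \<and>
             nondegenerate_on (g (f x)) (nu_perp B A f \<sigma> g D x))) \<and>
     (\<forall>x \<alpha>. f x \<in> U \<longrightarrow>
        blinfun_apply (J \<alpha> (f x)) ` nu B A f \<sigma> g D x = nu B A f \<sigma> g D x)"
proof -
  interpret CR_submanifold A B f \<sigma> g D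
    using assms by unfold_locales (auto simp: paraquaternionic_kaehler_def)
  note J = assms(3)
  have "direct_sum_of (nu_perp B A f \<sigma> g D x) (\<lambda>\<alpha>. nu_sub B A f g D J \<alpha> x)" if "f x \<in> U" for x
    by (simp add: direct_sum_of_nu_sub_iff[OF J that] nu_perp_eq_span)
  moreover have "blinfun_apply (J \<alpha> (f x)) ` nu_sub B A f g D J \<alpha> x = T x ` E x"
    if "f x \<in> U" for x \<alpha>
    unfolding nu_sub_def by (rule CR_point.J_J_P[OF CR_point[OF J that]])
  moreover have "blinfun_apply (J (p 1) (f x)) ` nu_sub B A f g D J (p 2) x = nu_sub B A f g D J (p 3) x"
    if "f x \<in> U" "p permutes (UNIV :: 3 set)" "evenperm p" for x p
    unfolding nu_sub_def even_permutation_3[OF that(2,3)]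
    by (rule CR_point.J_succ_P[OF CR_point[OF J that(1)]])
  moreover have "nu_perp B A f \<sigma> g D x \<subseteq> normal_fibre B A f g x \<and>
      nondegenerate_on (g (f x)) (nu_perp B A f \<sigma> g D x)" for x
  proof -
    \<comment> \<open>This claim concerns every point of N, including those with \<open>f x\<close>
      outside \<open>U\<close>, so a basis around \<open>f x\<close> has to be taken afresh.\<close>
    obtain U' J' where J': "canonical_basis A \<sigma> U' J'" "f x \<in> U'" using ex_canonical_basis by blast
    show ?thesis
      unfolding nu_perp_eq[OF J'] normal_fibre_eq
      using CR_point.Q_subset_N[OF CR_point[OF J']] CR_point.Q_nondegenerate[OF CR_point[OF J']] ..
  qed
  moreover have "dim (E x) = DIM('f) - rank_D" for x using dim_E[of x] by simp
  moreover have "blinfun_apply (J \<alpha> (f x)) ` nu B A f \<sigma> g D x = nu B A f \<sigma> g D x"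
    if "f x \<in> U" for x \<alpha>
    unfolding nu_def nu_perp_eq[OF J that] normal_fibre_eq
    by (rule CR_point.J_nu[OF CR_point[OF J that]])
  ultimately show ?thesis using subbundle_nu_perp by blast
qed

end
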